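(* Let $(B,g_B)$ and $(F,g_F)$ be pseudo-Riemannian manifolds with $\dim F>1$, let $f:B\to\mathbb{R}$ be a positive smooth function, and let $M=B\times_f F$ be the warped product with metric $\tilde g=g_B\oplus f^2g_F$. Suppose that $(M,\tilde g)$ is a gradient Yamabe soliton with potential function $h:B\times F\to\mathbb{R}$ of the form $h(x,y)=h_1(x)+h_2(y)$, where $h_1\in C^\infty(B)$ and $h_2\in C^\infty(F)$. Then one of the following cases occurs: (a) $M$ is the Riemannian product between a trivial gradient Yamabe soliton and a gradient Yamabe soliton; (b) $M$ is the Riemannian product between two gradient Yamabe solitons; (c) $M$ is the warped product between an almost gradient Yamabe soliton (the base) and a trivial gradient Yamabe soliton (the fiber).
   Context: A pseudo-Riemannian manifold $(M,g)$ is a gradient Yamabe soliton with potential function $h\in C^\infty(M)$ if there is a real constant $\rho$ such that $(S_g-\rho)g=\mathrm{Hess}_g(h)$, where $S_g$ is the scalar curvature of $g$. It is called trivial if its potential function is constant. It is called an almost gradient Yamabe soliton if the same equation holds with $\rho$ allowed to be a differentiable function on $M$ instead of a constant. The warped product $B\times_f F$ is the product manifold $B\times F$ with metric $\tilde g=g_B\oplus f^2g_F$, i.e. $\tilde g=\pi_B^*g_B+(f\circ\pi_B)^2\pi_F^*g_F$; $B$ is the base, $F$ the fiber. $M=B\times_f F$ is said to be a Riemannian product (of its factors $B$ and $F$) when the warping function $f$ is constant.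
   Formalization: B and F are additionally assumed connected; without this f or h_2 need only be locally constant, e.g. B two disjoint lines with f=1 and f=2, F the flat plane, h_1=0, h_2 a linear coordinate, where none of (a)–(c) holds with potentials h_1, h_2. *)

theory Defs
  imports "HOL-Analysis.Analysis"
begin

section \<open>Smooth manifolds\<close>

text \<open>Used on open sets \<open>S\<close> of finite-dimensional spaces, where this is the usual notion of
  a map of class \<open>C\<^sup>k\<close>.\<close>

primrec Ck_on :: "nat \<Rightarrow> ('e::real_normed_vector \<Rightarrow> 'f::real_normed_vector) \<Rightarrow> 'e set \<Rightarrow> bool" where
  "Ck_on 0 u S \<longleftrightarrow> continuous_on S u"
| "Ck_on (Suc k) u S \<longleftrightarrow>
     (\<forall>x\<in>S. u differentiable (at x)) \<and> (\<forall>v. Ck_on k (\<lambda>x. frechet_derivative u (at x) v) S)"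

definition smooth_on :: "('e::real_normed_vector \<Rightarrow> 'f::real_normed_vector) \<Rightarrow> 'e set \<Rightarrow> bool" where
  "smooth_on u S \<longleftrightarrow> (\<forall>k. Ck_on k u S)"

text \<open>A chart is a pair \<open>(U, \<phi>)\<close>; the values of \<open>\<phi>\<close> outside \<open>U\<close> are irrelevant. The model
  space \<open>'e\<close> is a copy of \<open>\<real>\<^sup>n\<close> with \<open>n = DIM('e)\<close>.\<close>

type_synonym ('p, 'e) chart = "'p set \<times> ('p \<Rightarrow> 'e)"

definition chart_image :: "('p, 'e) chart \<Rightarrow> 'e set" where
  "chart_image c = snd c ` fst c"

definition chart_inv :: "('p, 'e) chart \<Rightarrow> 'e \<Rightarrow> 'p" where
  "chart_inv c = inv_into (fst c) (snd c)"

record ('p, 'e) manifold =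
  top_of :: "'p topology"
  atlas :: "('p, 'e) chart set"

abbreviation points :: "('p, 'e) manifold \<Rightarrow> 'p set" where
  "points M \<equiv> topspace (top_of M)"

definition smooth_manifold :: "('p, 'e::euclidean_space) manifold \<Rightarrow> bool" where
  "smooth_manifold M \<longleftrightarrow>
     points M \<noteq> {} \<and> Hausdorff_space (top_of M) \<and> second_countable (top_of M) \<and>
     (\<Union>c\<in>atlas M. fst c) = points M \<and>
     (\<forall>c\<in>atlas M. openin (top_of M) (fst c) \<and> open (chart_image c) \<and>
        homeomorphic_map (subtopology (top_of M) (fst c)) (top_of_set (chart_image c)) (snd c)) \<and>
     (\<forall>c\<in>atlas M. \<forall>d\<in>atlas M. smooth_on (snd d \<circ> chart_inv c) (snd c ` (fst c \<inter> fst d)))"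

definition smooth_fun :: "('p, 'e::euclidean_space) manifold \<Rightarrow> ('p \<Rightarrow> real) \<Rightarrow> bool" where
  "smooth_fun M u \<longleftrightarrow> (\<forall>c\<in>atlas M. smooth_on (u \<circ> chart_inv c) (chart_image c))"

definition constant_fun :: "('p, 'e) manifold \<Rightarrow> ('p \<Rightarrow> real) \<Rightarrow> bool" where
  "constant_fun M u \<longleftrightarrow> (\<exists>a. \<forall>p\<in>points M. u p = a)"

definition prod_manifold ::
  "('p, 'e) manifold \<Rightarrow> ('q, 'f) manifold \<Rightarrow> ('p \<times> 'q, 'e \<times> 'f) manifold" where
  "prod_manifold M N =
     \<lparr>top_of = prod_topology (top_of M) (top_of N),
      atlas = {(fst c \<times> fst d, map_prod (snd c) (snd d)) | c d. c \<in> atlas M \<and> d \<in> atlas N}\<rparr>"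

section \<open>Tangent vectors and pseudo-Riemannian metrics\<close>

text \<open>A tangent vector at \<open>p\<close> is a derivation of the algebra of smooth functions at \<open>p\<close>, extended
  by \<open>0\<close> to the non-smooth functions so that it is determined by its values on smooth functions.
  Globally defined smooth functions suffice because of bump functions.
  \<open>coord_vec M c x v\<close> is the vector at \<open>chart_inv c x\<close> with components \<open>v\<close> in the chart \<open>c\<close>;
  the tangent space at \<open>chart_inv c x\<close> consists of these as \<open>v\<close> varies.\<close>

type_synonym 'p tangent = "('p \<Rightarrow> real) \<Rightarrow> real"

definition coord_vec ::
  "('p, 'e::euclidean_space) manifold \<Rightarrow> ('p, 'e) chart \<Rightarrow> 'e \<Rightarrow> 'e \<Rightarrow> 'p tangent" where
  "coord_vec M c x v =
     (\<lambda>u. if smooth_fun M u then frechet_derivative (u \<circ> chart_inv c) (at x) v else 0)"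

text \<open>The differential, at any point, of a smooth map \<open>\<pi>\<close> with values in \<open>N\<close>.\<close>

definition pushforward ::
  "('q, 'f::euclidean_space) manifold \<Rightarrow> ('p \<Rightarrow> 'q) \<Rightarrow> 'p tangent \<Rightarrow> 'q tangent" where
  "pushforward N \<pi> D = (\<lambda>u. if smooth_fun N u then D (u \<circ> \<pi>) else 0)"

text \<open>A field of bilinear forms assigns to each point a function of two tangent vectors there;
  its values on functionals that are not tangent vectors at the point are irrelevant.\<close>

type_synonym 'p form2 = "'p \<Rightarrow> 'p tangent \<Rightarrow> 'p tangent \<Rightarrow> real"

definition components ::
  "('p, 'e::euclidean_space) manifold \<Rightarrow> 'p form2 \<Rightarrow> ('p, 'e) chart \<Rightarrow> 'e \<Rightarrow> 'e \<Rightarrow> 'e \<Rightarrow> real" where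
  "components M g c x v w = g (chart_inv c x) (coord_vec M c x v) (coord_vec M c x w)"

text \<open>No condition on the index is imposed: it is locally constant by nondegeneracy.\<close>

definition pseudo_Riemannian :: "('p, 'e::euclidean_space) manifold \<Rightarrow> 'p form2 \<Rightarrow> bool" where
  "pseudo_Riemannian M g \<longleftrightarrow>
     smooth_manifold M \<and>
     (\<forall>c\<in>atlas M.
        (\<forall>x\<in>chart_image c.
           bilinear (components M g c x) \<and>
           (\<forall>v w. components M g c x v w = components M g c x w v) \<and>
           (\<forall>v. (\<forall>w. components M g c x v w = 0) \<longrightarrow> v = 0)) \<and>
        (\<forall>v w. smooth_on (\<lambda>x. components M g c x v w) (chart_image c)))"

definition warped_metric ::
  "('p, 'e::euclidean_space) manifold \<Rightarrow> 'p form2 \<Rightarrow> ('p \<Rightarrow> real) \<Rightarrow>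
   ('q, 'f::euclidean_space) manifold \<Rightarrow> 'q form2 \<Rightarrow> ('p \<times> 'q) form2" where
  "warped_metric B gB f F gF = (\<lambda>(x, y) D D'.
     gB x (pushforward B fst D) (pushforward B fst D') +
     (f x)\<^sup>2 * gF y (pushforward F snd D) (pushforward F snd D'))"

section \<open>Curvature and Hessian in a coordinate domain\<close>

text \<open>Here \<open>G x\<close> is the metric at the point \<open>x\<close> of an open subset of \<open>'e\<close>, and vectors
  \<open>u v w :: 'e\<close> also stand for the coordinate vector fields with these constant components.
  Conventions: \<open>R(u,v)w = \<nabla>\<^sub>u\<nabla>\<^sub>vw - \<nabla>\<^sub>v\<nabla>\<^sub>uw\<close> (coordinate fields commute), \<open>Ric(v,w)\<close> is the trace of
  \<open>u \<mapsto> R(u,v)w\<close>, and the scalar curvature is the trace of \<open>Ric\<close> with respect to \<open>G\<close>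
  (positive on round spheres).\<close>

definition pderiv_along :: "'e::euclidean_space \<Rightarrow> ('e \<Rightarrow> 'f::real_normed_vector) \<Rightarrow> 'e \<Rightarrow> 'f" where
  "pderiv_along v u x = frechet_derivative u (at x) v"

text \<open>The vector dual to the covector \<open>\<alpha>\<close> (raising the index).\<close>

definition sharp :: "('e::euclidean_space \<Rightarrow> 'e \<Rightarrow> real) \<Rightarrow> ('e \<Rightarrow> real) \<Rightarrow> 'e" where
  "sharp b \<alpha> = (THE z. \<forall>u. b z u = \<alpha> u)"

text \<open>\<open>christoffel G x v w\<close> is \<open>\<nabla>\<^sub>vw\<close> at \<open>x\<close> for the Levi-Civita connection, by the Koszul formula;
  its components for basis vectors \<open>v, w\<close> are the Christoffel symbols.\<close>

definition christoffel ::
  "('e::euclidean_space \<Rightarrow> 'e \<Rightarrow> 'e \<Rightarrow> real) \<Rightarrow> 'e \<Rightarrow> 'e \<Rightarrow> 'e \<Rightarrow> 'e" where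
  "christoffel G x v w = sharp (G x)
     (\<lambda>u. (pderiv_along v (\<lambda>y. G y w u) x + pderiv_along w (\<lambda>y. G y v u) x
            - pderiv_along u (\<lambda>y. G y v w) x) / 2)"

definition riemann ::
  "('e::euclidean_space \<Rightarrow> 'e \<Rightarrow> 'e \<Rightarrow> real) \<Rightarrow> 'e \<Rightarrow> 'e \<Rightarrow> 'e \<Rightarrow> 'e \<Rightarrow> 'e" where
  "riemann G x u v w =
     pderiv_along u (\<lambda>y. christoffel G y v w) x - pderiv_along v (\<lambda>y. christoffel G y u w) x
     + christoffel G x u (christoffel G x v w) - christoffel G x v (christoffel G x u w)"

definition ricci :: "('e::euclidean_space \<Rightarrow> 'e \<Rightarrow> 'e \<Rightarrow> real) \<Rightarrow> 'e \<Rightarrow> 'e \<Rightarrow> 'e \<Rightarrow> real" where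
  "ricci G x v w = (\<Sum>b\<in>Basis. riemann G x b v w \<bullet> b)"

definition scalar_curvature ::
  "('e::euclidean_space \<Rightarrow> 'e \<Rightarrow> 'e \<Rightarrow> real) \<Rightarrow> 'e \<Rightarrow> real" where
  "scalar_curvature G x = (\<Sum>b\<in>Basis. sharp (G x) (ricci G x b) \<bullet> b)"

definition hessian ::
  "('e::euclidean_space \<Rightarrow> 'e \<Rightarrow> 'e \<Rightarrow> real) \<Rightarrow> ('e \<Rightarrow> real) \<Rightarrow> 'e \<Rightarrow> 'e \<Rightarrow> 'e \<Rightarrow> real" where
  "hessian G u x v w =
     pderiv_along v (pderiv_along w u) x - pderiv_along (christoffel G x v w) u x"

section \<open>Gradient Yamabe solitons\<close>

text \<open>The tensor equation \<open>(S\<^sub>g - \<rho>) g = Hess\<^sub>g h\<close> on \<open>M\<close>, that is, equality of the components of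
  both sides in every chart of the atlas.\<close>

definition Yamabe_equation ::
  "('p, 'e::euclidean_space) manifold \<Rightarrow> 'p form2 \<Rightarrow> ('p \<Rightarrow> real) \<Rightarrow> ('p \<Rightarrow> real) \<Rightarrow> bool" where
  "Yamabe_equation M g \<rho> h \<longleftrightarrow>
     (\<forall>c\<in>atlas M. \<forall>x\<in>chart_image c. \<forall>v w.
        (scalar_curvature (components M g c) x - \<rho> (chart_inv c x)) * components M g c x v w
        = hessian (components M g c) (h \<circ> chart_inv c) x v w)"

definition gradient_Yamabe_soliton ::
  "('p, 'e::euclidean_space) manifold \<Rightarrow> 'p form2 \<Rightarrow> ('p \<Rightarrow> real) \<Rightarrow> bool" where
  "gradient_Yamabe_soliton M g h \<longleftrightarrow>
     pseudo_Riemannian M g \<and> smooth_fun M h \<and> (\<exists>\<rho>::real. Yamabe_equation M g (\<lambda>_. \<rho>) h)"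

definition trivial_gradient_Yamabe_soliton ::
  "('p, 'e::euclidean_space) manifold \<Rightarrow> 'p form2 \<Rightarrow> ('p \<Rightarrow> real) \<Rightarrow> bool" where
  "trivial_gradient_Yamabe_soliton M g h \<longleftrightarrow> gradient_Yamabe_soliton M g h \<and> constant_fun M h"

definition almost_gradient_Yamabe_soliton ::
  "('p, 'e::euclidean_space) manifold \<Rightarrow> 'p form2 \<Rightarrow> ('p \<Rightarrow> real) \<Rightarrow> bool" where
  "almost_gradient_Yamabe_soliton M g h \<longleftrightarrow>
     pseudo_Riemannian M g \<and> smooth_fun M h \<and>
     (\<exists>\<rho>. smooth_fun M \<rho> \<and> Yamabe_equation M g \<rho> h)"

end

theory Submission
  imports Defs
begin

text \<open>For \<open>v\<close> tangent to the base and \<open>w\<close> tangent to the fiber, the \<open>(v, w)\<close> component of the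
  soliton equation is \<open>df(v) dh\<^sub>2(w) = 0\<close>, because the metric has no mixed components and
  \<open>\<nabla>\<^sub>vw = (df(v) / f) w\<close>. Hence \<open>f\<close> or \<open>h\<^sub>2\<close> is constant. The base component determines the
  scalar curvature \<open>S\<close> of the warped product as a function on the base, and
  \<open>S = S\<^sub>B + S\<^sub>F / f\<^sup>2 - 2n \<Delta>f / f - n (n - 1) \<bar>\<nabla>f\<bar>\<^sup>2 / f\<^sup>2\<close>, where \<open>n\<close> is the dimension of the
  fiber, so \<open>S\<^sub>F\<close> is constant. If \<open>f\<close> is constant, the base component is then a soliton equation;
  so is the fiber component, which for fixed base point has \<open>S\<^sub>B\<close> as a constant and no \<open>\<nabla>f\<close> term.
  If \<open>h\<^sub>2\<close> is constant, the constancy of \<open>S\<^sub>F\<close> makes the fiber a trivial soliton, and the terms by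
  which \<open>S\<close> differs from \<open>S\<^sub>B\<close> are absorbed in the function \<open>\<rho>\<close> of the base. They are smooth and
  independent of the chart, because the gradient and the Hessian are.\<close>

section \<open>Calculus of smooth maps\<close>

text \<open>The curvature of the product is obtained by differentiating its connection, and the
  connection is given by raising an index, a \<open>THE\<close> description. Its smoothness is
  therefore the analytic core. Implicit differentiation of \<open>G x (z x) u = \<alpha> x u\<close>
  shows that the derivative of a raised covector field is again a raised covector field, so every
  order of smoothness follows by induction, without an inverse matrix. The metrics may be
  indefinite: nondegeneracy enters as injectivity of lowering an index, and equations are divided by
  a nonzero value of the metric on a pair of vectors, never by a length. If \<open>h2\<close> is
  constant, \<rho> has to be one function on the base, whereas gradient and Laplacian are given in
  charts; hence the transformation rules under transition maps. Connectedness of the factors turns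
  vanishing derivatives into constancy.\<close>

lemma pderiv_along_cong:
  assumes "open S" "x \<in> S" "\<And>y. y \<in> S \<Longrightarrow> u y = u' y"
  shows "pderiv_along v u x = pderiv_along v u' x"
proof -
  \<comment> \<open>\<open>frechet_derivative\<close> is a choice among the derivatives at
    \<open>x\<close>. Both maps have the same derivatives, hence the same choice, whether or not
    they are differentiable.\<close>
  have "(u has_derivative D) (at x) \<longleftrightarrow> (u' has_derivative D) (at x)" for D
    using assms has_derivative_transform_within_open[of u D x UNIV S u']
      has_derivative_transform_within_open[of u' D x UNIV S u] by auto
  then show ?thesis
    by (simp add: pderiv_along_def frechet_derivative_def)
qed

lemma pderiv_along_eq: "(u has_derivative D) (at x) \<Longrightarrow> pderiv_along v u x = D v"
  by (metis frechet_derivative_at pderiv_along_def)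

lemma has_derivative_pderiv_along:
  "u differentiable (at x) \<Longrightarrow> (u has_derivative (\<lambda>v. pderiv_along v u x)) (at x)"
  by (simp add: pderiv_along_def frechet_derivative_works)

lemma linear_pderiv_along:
  "u differentiable (at x) \<Longrightarrow> linear (\<lambda>v. pderiv_along v u x)"
  by (simp add: pderiv_along_def linear_frechet_derivative)

lemma pderiv_along_zero: "u differentiable (at x) \<Longrightarrow> pderiv_along 0 u x = 0"
  by (rule linear_0[OF linear_pderiv_along])

lemma pderiv_along_const [simp]: "pderiv_along v (\<lambda>_. a) x = 0"
  by (simp add: pderiv_along_def)

lemma pderiv_along_add:
  "u differentiable (at x) \<Longrightarrow> w differentiable (at x) \<Longrightarrow>
    pderiv_along v (\<lambda>y. u y + w y) x = pderiv_along v u x + pderiv_along v w x"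
  by (rule pderiv_along_eq) (intro has_derivative_add has_derivative_pderiv_along)

lemma pderiv_along_diff:
  "u differentiable (at x) \<Longrightarrow> w differentiable (at x) \<Longrightarrow>
    pderiv_along v (\<lambda>y. u y - w y) x = pderiv_along v u x - pderiv_along v w x"
  by (rule pderiv_along_eq) (intro has_derivative_diff has_derivative_pderiv_along)

lemma pderiv_along_bounded_bilinear:
  assumes "bounded_bilinear p" "u differentiable (at x)" "w differentiable (at x)"
  shows "pderiv_along v (\<lambda>y. p (u y) (w y)) x =
    p (u x) (pderiv_along v w x) + p (pderiv_along v u x) (w x)"
  by (rule pderiv_along_eq)
    (intro bounded_bilinear.FDERIV[OF assms(1)] has_derivative_pderiv_along assms)

lemmas pderiv_along_scaleR = pderiv_along_bounded_bilinear[OF bounded_bilinear_scaleR]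
lemmas pderiv_along_mult =
  pderiv_along_bounded_bilinear[OF bounded_bilinear_mult[where 'a=real]]

lemma pderiv_along_sum:
  "(\<And>i. i \<in> I \<Longrightarrow> u i differentiable (at x)) \<Longrightarrow>
    pderiv_along v (\<lambda>y. \<Sum>i\<in>I. u i y) x = (\<Sum>i\<in>I. pderiv_along v (u i) x)"
  by (rule pderiv_along_eq) (intro has_derivative_sum has_derivative_pderiv_along)

lemma pderiv_along_compose:
  assumes "(T has_derivative T') (at x)" "u differentiable (at (T x))"
  shows "pderiv_along v (\<lambda>y. u (T y)) x = pderiv_along (T' v) u (T x)"
  by (rule pderiv_along_eq) (rule has_derivative_compose[OF assms(1) has_derivative_pderiv_along[OF assms(2)]])

lemma pderiv_along_linear_compose:
  assumes "bounded_linear L" "u differentiable (at x)"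
  shows "pderiv_along v (\<lambda>y. L (u y)) x = L (pderiv_along v u x)"
  by (rule pderiv_along_eq) (rule bounded_linear.has_derivative[OF assms(1) has_derivative_pderiv_along[OF assms(2)]])

section \<open>Maps of class C^k\<close>

lemma Ck_on_Suc: "Ck_on (Suc k) u S \<longleftrightarrow>
    (\<forall>x\<in>S. u differentiable (at x)) \<and> (\<forall>v. Ck_on k (pderiv_along v u) S)"
  unfolding Ck_on.simps pderiv_along_def ..

declare Ck_on.simps(2) [simp del]

lemma Ck_on_cong:
  fixes u :: "'e::euclidean_space \<Rightarrow> 'f::real_normed_vector"
  assumes "open S" "Ck_on k u S" "\<And>x. x \<in> S \<Longrightarrow> u x = u' x"
  shows "Ck_on k u' S"
  using assms(2,3)
proof (induction k arbitrary: u u')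
  case 0
  then show ?case by (simp cong: continuous_on_cong_simp)
next
  case (Suc k)
  have "u' differentiable (at x)" if "x \<in> S" for x
    using Suc.prems that assms(1) has_derivative_transform_within_open[of u _ x UNIV S u']
    unfolding Ck_on_Suc differentiable_def by blast
  moreover have "Ck_on k (pderiv_along v u') S" for v
  proof (rule Suc.IH)
    show "Ck_on k (pderiv_along v u) S" using Suc.prems(1) by (simp add: Ck_on_Suc)
    show "pderiv_along v u x = pderiv_along v u' x" if "x \<in> S" for x
      using pderiv_along_cong[OF assms(1) that Suc.prems(2)] .
  qed
  ultimately show ?case by (simp add: Ck_on_Suc)
qed

lemma Ck_on_continuous_on:
  fixes u :: "'e::euclidean_space \<Rightarrow> 'f::real_normed_vector"
  assumes "Ck_on k u S" shows "continuous_on S u"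
  using assms by (cases k)
   (auto simp: Ck_on_Suc continuous_at_imp_continuous_on differentiable_imp_continuous_within)

lemma Ck_on_SucD:
  fixes u :: "'e::euclidean_space \<Rightarrow> 'f::real_normed_vector"
  shows "Ck_on (Suc k) u S \<Longrightarrow> Ck_on k u S"
proof (induction k arbitrary: u)
  case 0
  then show ?case by (simp add: Ck_on_continuous_on)
next
  case (Suc k)
  then show ?case by (metis Ck_on_Suc)
qed

lemma Ck_on_const: 
  fixes a :: "'f::real_normed_vector"
  shows "Ck_on k (\<lambda>x::'e::euclidean_space. a) S"
proof (induction k arbitrary: a)
  case (Suc k)
  have "pderiv_along v (\<lambda>x::'e. a) = (\<lambda>x. 0)" for v by (rule ext) simp
  then show ?case using Suc by (simp add: Ck_on_Suc)
qed simp

lemma Ck_on_add: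
  fixes u :: "'e::euclidean_space \<Rightarrow> 'f::real_normed_vector"
  assumes "open S" "Ck_on k u S" "Ck_on k w S"
  shows "Ck_on k (\<lambda>x. u x + w x) S"
  using assms(2,3)
proof (induction k arbitrary: u w)
  case 0
  then show ?case by (simp add: continuous_on_add)
next
  case (Suc k)
  have "Ck_on k (pderiv_along v (\<lambda>x. u x + w x)) S" for v
    by (rule Ck_on_cong[OF assms(1) Suc.IH[of "pderiv_along v u" "pderiv_along v w"]])
      (use Suc.prems in \<open>auto simp: Ck_on_Suc pderiv_along_add\<close>)
  then show ?case using Suc.prems by (simp add: Ck_on_Suc)
qed

lemma Ck_on_sum:
  fixes u :: "'i \<Rightarrow> 'e::euclidean_space \<Rightarrow> 'f::real_normed_vector"
  assumes "open S" "\<And>i. i \<in> I \<Longrightarrow> Ck_on k (u i) S"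
  shows "Ck_on k (\<lambda>x. \<Sum>i\<in>I. u i x) S"
  using assms(2)
  by (induction I rule: infinite_finite_induct) (auto intro: Ck_on_const Ck_on_add[OF assms(1)])

text \<open>By the product rule the derivative is a sum of two products of the same kind, in each of
  which one factor is undifferentiated and is merely weakened from C^(k+1) to C^k. A general
  \<open>p\<close> covers multiplication, scaling and the inner product at once.\<close>

lemma Ck_on_bounded_bilinear:
  fixes u :: "'e::euclidean_space \<Rightarrow> 'f::real_normed_vector"
    and w :: "'e \<Rightarrow> 'g::real_normed_vector"
  assumes "bounded_bilinear p" "open S" "Ck_on k u S" "Ck_on k w S"
  shows "Ck_on k (\<lambda>x. p (u x) (w x)) S"
  using assms(3,4)
proof (induction k arbitrary: u w)
  case 0
  then show ?case by (simp add: bounded_bilinear.continuous_on[OF assms(1)])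
next
  case (Suc k)
  have "Ck_on k (pderiv_along v (\<lambda>x. p (u x) (w x))) S" for v
    by (rule Ck_on_cong[OF assms(2) Ck_on_add[OF assms(2)
            Suc.IH[of u "pderiv_along v w"] Suc.IH[of "pderiv_along v u" w]]])
      (use Suc.prems in \<open>auto simp: Ck_on_Suc[of k] pderiv_along_bounded_bilinear[OF assms(1)] intro: Ck_on_SucD\<close>)
  moreover have "(\<lambda>x. p (u x) (w x)) differentiable (at x)" if "x \<in> S" for x
    using Suc.prems that bounded_bilinear.FDERIV[OF assms(1)]
    unfolding Ck_on_Suc differentiable_def by blast
  ultimately show ?case by (simp add: Ck_on_Suc)
qed

lemma pderiv_along_inverse:
  fixes u :: "'e::euclidean_space \<Rightarrow> real"
  assumes "u differentiable (at x)" "u x \<noteq> 0"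
  shows "pderiv_along v (\<lambda>y. inverse (u y)) x = - (inverse (u x) * inverse (u x)) * pderiv_along v u x"
  by (rule pderiv_along_eq)
    (auto intro!: derivative_eq_intros has_derivative_pderiv_along assms)

lemma Ck_on_mult:
  fixes u :: "'e::euclidean_space \<Rightarrow> real"
  shows "open S \<Longrightarrow> Ck_on k u S \<Longrightarrow> Ck_on k w S \<Longrightarrow> Ck_on k (\<lambda>x. u x * w x) S"
  by (rule Ck_on_bounded_bilinear[OF bounded_bilinear_mult])

text \<open>A bootstrap: the derivative of \<open>1/u\<close> is \<open>-(1/u)^2\<close> times that
  of \<open>u\<close>, so it involves \<open>1/u\<close> only to the order supplied by the induction
  hypothesis.\<close>

lemma Ck_on_inverse:
  fixes u :: "'e::euclidean_space \<Rightarrow> real"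
  assumes "open S" "Ck_on k u S" "\<And>x. x \<in> S \<Longrightarrow> u x \<noteq> 0"
  shows "Ck_on k (\<lambda>x. inverse (u x)) S"
  using assms(2)
proof (induction k)
  case 0
  then show ?case using assms(3) by (simp add: continuous_on_inverse)
next
  case (Suc k)
  let ?i = "\<lambda>x. inverse (u x)"
  have i: "Ck_on k ?i S" using Suc.IH Suc.prems Ck_on_SucD by blast
  have "Ck_on k (\<lambda>x. - 1 * (?i x * ?i x) * pderiv_along v u x) S" for v
    using Suc.prems i by (intro Ck_on_mult assms(1) Ck_on_const) (auto simp: Ck_on_Suc)
  then have "Ck_on k (pderiv_along v ?i) S" for v
    by (rule Ck_on_cong[OF assms(1)])
      (use Suc.prems assms(3) in \<open>auto simp: Ck_on_Suc pderiv_along_inverse\<close>)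
  then show ?case using Suc.prems assms(3) by (simp add: Ck_on_Suc)
qed

text \<open>A linear map is its own derivative, so the derivative along \<open>v\<close> is the
  derivative of \<open>u\<close> along \<open>L v\<close>, again composed with \<open>L\<close>. The
  maps \<open>L\<close> that occur are the two projections of a product.\<close>

lemma Ck_on_linear_compose:
  fixes u :: "'e::euclidean_space \<Rightarrow> 'f::real_normed_vector" and L :: "'g::euclidean_space \<Rightarrow> 'e"
  assumes "Ck_on k u S" "linear L" "open S'" "L ` S' \<subseteq> S"
  shows "Ck_on k (\<lambda>x. u (L x)) S'"
  using assms(1)
proof (induction k arbitrary: u)
  case 0
  have "continuous_on S' L"
    using assms(2) linear_continuous_on linear_conv_bounded_linear by blast
  with 0 show ?case using assms(4) by (auto intro: continuous_on_compose2)
next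
  case (Suc k)
  have L: "(L has_derivative L) (at x)" for x
    using assms(2) by (simp add: linear_conv_bounded_linear bounded_linear_imp_has_derivative)
  have u: "u differentiable (at (L x))" if "x \<in> S'" for x
    using that assms(4) Suc.prems by (auto simp: Ck_on_Suc)
  have "Ck_on k (pderiv_along v (\<lambda>x. u (L x))) S'" for v
    by (rule Ck_on_cong[OF assms(3), of _ "\<lambda>x. pderiv_along (L v) u (L x)"])
      (use Suc u in \<open>auto simp: Ck_on_Suc pderiv_along_compose[OF L]\<close>)
  moreover have "(\<lambda>x. u (L x)) differentiable (at x)" if "x \<in> S'" for x
    using has_derivative_compose[OF L has_derivative_pderiv_along[OF u[OF that]]]
    unfolding differentiable_def by blast
  ultimately show ?case by (simp add: Ck_on_Suc)
qed

lemma smooth_onD: 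
  fixes u :: "'e::euclidean_space \<Rightarrow> 'f::real_normed_vector"
  shows "smooth_on u S \<Longrightarrow> x \<in> S \<Longrightarrow> u differentiable (at x)"
  using Ck_on_Suc[of 0 u S] by (simp add: smooth_on_def del: Ck_on.simps)

lemma smooth_on_pderiv_along: 
  fixes u :: "'e::euclidean_space \<Rightarrow> 'f::real_normed_vector"
  shows "smooth_on u S \<Longrightarrow> smooth_on (pderiv_along v u) S"
  unfolding smooth_on_def using Ck_on_Suc[of _ u S] by blast

context
  fixes S :: "'e::euclidean_space set"
  assumes S: "open S"
begin

lemma smooth_on_cong:
  "smooth_on u S \<Longrightarrow> (\<And>x. x \<in> S \<Longrightarrow> u x = u' x) \<Longrightarrow> smooth_on u' S"
  unfolding smooth_on_def using Ck_on_cong[OF S] by blast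

lemma smooth_on_const: "smooth_on (\<lambda>x. a) S"
  by (simp add: smooth_on_def Ck_on_const)

lemma smooth_on_add: "smooth_on u S \<Longrightarrow> smooth_on w S \<Longrightarrow> smooth_on (\<lambda>x. u x + w x) S"
  by (simp add: smooth_on_def Ck_on_add S)

lemma smooth_on_sum: "(\<And>i. i \<in> I \<Longrightarrow> smooth_on (u i) S) \<Longrightarrow> smooth_on (\<lambda>x. \<Sum>i\<in>I. u i x) S"
  by (simp add: smooth_on_def Ck_on_sum S)

lemma smooth_on_bounded_bilinear:
  "bounded_bilinear p \<Longrightarrow> smooth_on u S \<Longrightarrow> smooth_on w S \<Longrightarrow> smooth_on (\<lambda>x. p (u x) (w x)) S"
  by (simp add: smooth_on_def Ck_on_bounded_bilinear S)

lemmas smooth_on_mult = smooth_on_bounded_bilinear[OF bounded_bilinear_mult[where 'a=real]]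
lemmas smooth_on_scaleR = smooth_on_bounded_bilinear[OF bounded_bilinear_scaleR]
lemmas smooth_on_inner = smooth_on_bounded_bilinear[OF bounded_bilinear_inner]

lemma smooth_on_diff:
  fixes u :: "'e \<Rightarrow> real"
  assumes "smooth_on u S" "smooth_on w S" shows "smooth_on (\<lambda>x. u x - w x) S"
  using smooth_on_add[OF assms(1) smooth_on_mult[OF smooth_on_const[of "-1"] assms(2)]] by simp

lemma smooth_on_inverse:
  "smooth_on u S \<Longrightarrow> (\<And>x. x \<in> S \<Longrightarrow> u x \<noteq> (0::real)) \<Longrightarrow> smooth_on (\<lambda>x. inverse (u x)) S"
  by (simp add: smooth_on_def Ck_on_inverse S)

lemma smooth_on_linear_compose:
  fixes L :: "'e \<Rightarrow> 'f::euclidean_space"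
  shows "smooth_on u S' \<Longrightarrow> linear L \<Longrightarrow> L ` S \<subseteq> S' \<Longrightarrow> smooth_on (\<lambda>x. u (L x)) S"
  unfolding smooth_on_def using Ck_on_linear_compose[OF _ _ S, of _ u S' L] by blast

end


section \<open>Symmetry of second derivatives\<close>

lemma second_difference:
  fixes u :: "'e::euclidean_space \<Rightarrow> real"
  assumes S: "ball x r \<subseteq> S" "open S" and u: "Ck_on 2 u S"
    and s: "0 < s" "s * (norm v + norm w) < r"
  obtains y where "norm (y - x) \<le> s * (norm v + norm w)"
    "u (x + s *\<^sub>R v + s *\<^sub>R w) - u (x + s *\<^sub>R v) - u (x + s *\<^sub>R w) + u x
      = s\<^sup>2 * pderiv_along w (pderiv_along v u) y"
proof -
  have u1: "u differentiable (at y)" if "y \<in> S" for y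
    using u that by (simp add: numeral_2_eq_2 Ck_on_Suc)
  have u2: "pderiv_along v u differentiable (at y)" if "y \<in> S" for y
    using u that by (simp add: numeral_2_eq_2 Ck_on_Suc)
  have near: "norm (a *\<^sub>R v + b *\<^sub>R w) \<le> s * (norm v + norm w)"
    if "0 \<le> a" "a \<le> s" "0 \<le> b" "b \<le> s" for a b
  proof -
    have "norm (a *\<^sub>R v + b *\<^sub>R w) \<le> a * norm v + b * norm w"
      using norm_triangle_ineq[of "a *\<^sub>R v" "b *\<^sub>R w"] that by simp
    also have "\<dots> \<le> s * norm v + s * norm w"
      using that by (intro add_mono mult_right_mono) auto
    finally show ?thesis by (simp add: distrib_left)
  qed
  have inS: "x + a *\<^sub>R v + b *\<^sub>R w \<in> S" if "0 \<le> a" "a \<le> s" "0 \<le> b" "b \<le> s" for a b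
  proof -
    have "dist x (x + a *\<^sub>R v + b *\<^sub>R w) < r"
      using near[OF that] s(2) by (simp add: dist_norm norm_minus_commute algebra_simps)
    then show ?thesis using S(1) by auto
  qed
  have along: "((\<lambda>t. g (z + t *\<^sub>R d)) has_real_derivative pderiv_along d g (z + t *\<^sub>R d)) (at t)"
    if "g differentiable (at (z + t *\<^sub>R d))" for g :: "'e \<Rightarrow> real" and z d t
  proof -
    have "((\<lambda>t. z + t *\<^sub>R d) has_derivative (\<lambda>h. h *\<^sub>R d)) (at t)"
      by (auto intro!: derivative_eq_intros)
    from has_derivative_compose[OF this has_derivative_pderiv_along[OF that]]
    show ?thesis
      by (simp add: has_field_derivative_def linear_cmul[OF linear_pderiv_along[OF that]] mult.commute[of _ "pderiv_along d g _"])
  qed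
  \<comment> \<open>The second difference is \<open>g s - g 0\<close>. The mean value theorem is
    applied to it in direction \<open>v\<close> and then to the derivative in direction
    \<open>w\<close>. The second difference is symmetric in \<open>v\<close> and \<open>w\<close>;
    the intermediate point depends on the order.\<close>
  define g where "g t = u (x + s *\<^sub>R w + t *\<^sub>R v) - u (x + t *\<^sub>R v)" for t
  have "\<exists>z. 0 < z \<and> z < s \<and> g s - g 0 = (s - 0) *
      (pderiv_along v u (x + s *\<^sub>R w + z *\<^sub>R v) - pderiv_along v u (x + z *\<^sub>R v))"
    unfolding g_def
    using s(1) inS[of _ s] inS[of _ 0]
    by (intro MVT2 DERIV_diff along u1) (auto simp: add_ac)
  then obtain a where a: "0 < a" "a < s" "g s - g 0 = s *
      (pderiv_along v u (x + s *\<^sub>R w + a *\<^sub>R v) - pderiv_along v u (x + a *\<^sub>R v))"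
    by auto
  have "\<exists>z. 0 < z \<and> z < s \<and> pderiv_along v u (x + a *\<^sub>R v + s *\<^sub>R w) - pderiv_along v u (x + a *\<^sub>R v + 0 *\<^sub>R w)
      = (s - 0) * pderiv_along w (pderiv_along v u) (x + a *\<^sub>R v + z *\<^sub>R w)"
    using s(1) a inS[of a]
    by (intro MVT2 along u2) auto
  then obtain b where b: "0 < b" "b < s"
    "pderiv_along v u (x + a *\<^sub>R v + s *\<^sub>R w) - pderiv_along v u (x + a *\<^sub>R v)
      = s * pderiv_along w (pderiv_along v u) (x + a *\<^sub>R v + b *\<^sub>R w)"
    by auto
  show thesis
  proof (rule that)
    show "norm ((x + a *\<^sub>R v + b *\<^sub>R w) - x) \<le> s * (norm v + norm w)"
      using near[of a b] a b by (simp add: add.assoc)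
    show "u (x + s *\<^sub>R v + s *\<^sub>R w) - u (x + s *\<^sub>R v) - u (x + s *\<^sub>R w) + u x
      = s\<^sup>2 * pderiv_along w (pderiv_along v u) (x + a *\<^sub>R v + b *\<^sub>R w)"
      using a(3) b(3) by (simp add: g_def power2_eq_square add_ac)
  qed
qed

text \<open>Computed in the two orders, one second difference is \<open>s^2\<close> times either
  mixed derivative at points close to \<open>x\<close>. If the derivatives differed at
  \<open>x\<close>, continuity would keep their values near \<open>x\<close> apart.\<close>

lemma pderiv_along_commute_real:
  fixes u :: "'e::euclidean_space \<Rightarrow> real"
  assumes S: "open S" "x \<in> S" and u: "Ck_on 2 u S"
  shows "pderiv_along v (pderiv_along w u) x = pderiv_along w (pderiv_along v u) x"
proof (rule ccontr)
  let ?A = "pderiv_along v (pderiv_along w u)" and ?B = "pderiv_along w (pderiv_along v u)"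
  assume ne: "?A x \<noteq> ?B x"
  define e where "e = dist (?A x) (?B x) / 2"
  have e: "e > 0" using ne by (simp add: e_def)
  have cont: "isCont ?A x" "isCont ?B x"
    using u S by (auto simp: numeral_2_eq_2 Ck_on_Suc continuous_on_eq_continuous_at)
  obtain d1 where d1: "d1 > 0" "\<And>y. dist y x < d1 \<Longrightarrow> dist (?A y) (?A x) < e"
    using cont(1) e unfolding continuous_at_eps_delta by blast
  obtain d2 where d2: "d2 > 0" "\<And>y. dist y x < d2 \<Longrightarrow> dist (?B y) (?B x) < e"
    using cont(2) e unfolding continuous_at_eps_delta by blast
  obtain d3 where d3: "d3 > 0" "ball x d3 \<subseteq> S"
    using S open_contains_ball by blast
  define r where "r = min d1 (min d2 d3)"
  have r: "r > 0" "ball x r \<subseteq> S" using d1 d2 d3 by (auto simp: r_def)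
  \<comment> \<open>The two points then stay within \<open>r / 2\<close> of \<open>x\<close>. The
    summand 1 keeps the denominator positive when \<open>v\<close> and \<open>w\<close> are both
    0.\<close>
  define s where "s = r / (2 * (norm v + norm w + 1))"
  have s: "s > 0" using r(1) unfolding s_def
    by (intro divide_pos_pos) (auto intro: add_nonneg_pos)
  have "s * (norm v + norm w) \<le> s * (norm v + norm w + 1)" using s by (simp add: distrib_left)
  also have "\<dots> = r / 2"
    using add_nonneg_pos[of "norm v + norm w" 1] by (simp add: s_def field_simps)
  also have "\<dots> < r" using r by simp
  finally have sr: "s * (norm v + norm w) < r" .
  obtain y where y: "norm (y - x) \<le> s * (norm v + norm w)"
    "u (x + s *\<^sub>R v + s *\<^sub>R w) - u (x + s *\<^sub>R v) - u (x + s *\<^sub>R w) + u x = s\<^sup>2 * ?B y"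
    using second_difference[OF r(2) S(1) u s sr] by blast
  obtain z where z: "norm (z - x) \<le> s * (norm w + norm v)"
    "u (x + s *\<^sub>R w + s *\<^sub>R v) - u (x + s *\<^sub>R w) - u (x + s *\<^sub>R v) + u x = s\<^sup>2 * ?A z"
    using second_difference[OF r(2) S(1) u s, of w v] sr by (metis add.commute)
  have swap: "x + s *\<^sub>R w + s *\<^sub>R v = x + s *\<^sub>R v + s *\<^sub>R w" by (simp add: add_ac)
  have "s\<^sup>2 * ?B y = s\<^sup>2 * ?A z"
    using y(2) z(2) unfolding swap by linarith
  then have "?B y = ?A z" using s by simp
  moreover have "dist (?B y) (?B x) < e" "dist (?A z) (?A x) < e"
    using d1(2)[of z] d2(2)[of y] y(1) z(1) sr by (auto simp: dist_norm r_def algebra_simps)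
  ultimately show False
    unfolding e_def dist_real_def by argo
qed

text \<open>The vector-valued form is the one needed for transition maps; pairing with basis vectors
  reduces it to real functions.\<close>

lemma pderiv_along_commute:
  fixes u :: "'e::euclidean_space \<Rightarrow> 'f::euclidean_space"
  assumes S: "open S" "x \<in> S" and u: "smooth_on u S"
  shows "pderiv_along v (pderiv_along w u) x = pderiv_along w (pderiv_along v u) x"
proof (rule euclidean_eqI)
  fix b :: 'f
  have ub: "smooth_on (\<lambda>x. u x \<bullet> b) S"
    using S(1) u by (intro smooth_on_inner smooth_on_const)
  have *: "pderiv_along v (pderiv_along w u) x \<bullet> b = pderiv_along v (pderiv_along w (\<lambda>x. u x \<bullet> b)) x" for v w
  proof -
    have "pderiv_along v (pderiv_along w u) x \<bullet> b = pderiv_along v (\<lambda>y. pderiv_along w u y \<bullet> b) x"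
      using smooth_onD[OF smooth_on_pderiv_along[OF u] S(2)]
      by (intro pderiv_along_linear_compose[symmetric] bounded_linear_inner_left)
    also have "\<dots> = pderiv_along v (pderiv_along w (\<lambda>x. u x \<bullet> b)) x"
      by (intro pderiv_along_cong[OF S] pderiv_along_linear_compose[symmetric] bounded_linear_inner_left smooth_onD[OF u])
    finally show ?thesis .
  qed
  show "pderiv_along v (pderiv_along w u) x \<bullet> b = pderiv_along w (pderiv_along v u) x \<bullet> b"
    unfolding * using ub S by (intro pderiv_along_commute_real[of S]) (auto simp: smooth_on_def)
qed

section \<open>Raising an index\<close>

definition nondegenerate_form :: "('e::euclidean_space \<Rightarrow> 'e \<Rightarrow> real) \<Rightarrow> bool" where
  "nondegenerate_form b \<longleftrightarrow> bilinear b \<and> (\<forall>v. (\<forall>w. b v w = 0) \<longrightarrow> v = 0)"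

lemma nondegenerate_formD: "nondegenerate_form b \<Longrightarrow> bilinear b"
  by (simp add: nondegenerate_form_def)

lemma linear_expand:
  fixes L :: "'e::euclidean_space \<Rightarrow> 'f::real_vector"
  assumes "linear L" shows "L v = (\<Sum>b\<in>Basis. (v \<bullet> b) *\<^sub>R L b)"
  using linear_sum[OF assms, of "\<lambda>b. (v \<bullet> b) *\<^sub>R b" Basis]
  by (simp add: euclidean_representation linear_cmul[OF assms])

lemma linear_sum_inner: "linear (\<lambda>v::'e::euclidean_space. \<Sum>b\<in>Basis. (v \<bullet> b) * (k b :: real))"
  by (rule linearI) (simp_all add: inner_add_left algebra_simps sum.distrib sum_distrib_left)

lemma linear_eq_on_Basis:
  fixes L :: "'e::euclidean_space \<Rightarrow> 'f::real_vector"
  assumes "linear L" "linear L'" "\<And>b. b \<in> Basis \<Longrightarrow> L b = L' b" shows "L v = L' v"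
  by (simp add: linear_expand[OF assms(1), of v] linear_expand[OF assms(2), of v] assms(3))

context
  fixes b :: "'e::euclidean_space \<Rightarrow> 'e \<Rightarrow> real"
  assumes b: "nondegenerate_form b"
begin

text \<open>Lowering an index, with covectors identified with vectors through the Euclidean inner
  product. Nondegeneracy of \<open>b\<close> is injectivity of this endomorphism.\<close>

private definition flat :: "'e \<Rightarrow> 'e" where
  "flat v = (\<Sum>c\<in>Basis. b v c *\<^sub>R c)"

private lemma flat_inner: "c \<in> Basis \<Longrightarrow> flat v \<bullet> c = b v c"
  by (simp add: flat_def)

private lemma linear_flat: "linear flat"
  using nondegenerate_formD[OF b]
  by (auto intro!: linearI
      simp: flat_def bilinear_ladd bilinear_lmul sum.distrib scaleR_add_left scaleR_sum_right)

lemma form_eqI: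
  assumes "\<And>u. b z u = b z' u" shows "z = z'"
proof -
  have "b (z - z') u = 0" for u
    using assms bilinear_lsub[OF nondegenerate_formD[OF b]] by simp
  then have "z - z' = 0" using b unfolding nondegenerate_form_def by blast
  then show ?thesis by simp
qed

private lemma inj_flat: "inj flat"
proof (rule injI)
  fix v w assume "flat v = flat w"
  then have "b v c = b w c" if "c \<in> Basis" for c using that by (metis flat_inner)
  then have "b v u = b w u" for u
    using nondegenerate_formD[OF b] linear_eq_on_Basis[of "b v" "b w"] by (simp add: bilinear_def)
  then show "v = w" by (rule form_eqI)
qed

lemma sharp_eqI:
  assumes "\<And>u. b z u = \<alpha> u" shows "sharp b \<alpha> = z"
  unfolding sharp_def
proof (rule the_equality)
  fix z' assume "\<forall>u. b z' u = \<alpha> u"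
  then show "z' = z" using assms by (intro form_eqI) simp
qed (simp add: assms)

text \<open>In finite dimension the injective \<open>flat\<close> is surjective, so a vector
  representing \<alpha> exists. Linearity of \<alpha> is what allows the comparison to be made on
  basis vectors only.\<close>

lemma form_sharp:
  assumes \<alpha>: "linear \<alpha>" shows "b (sharp b \<alpha>) u = \<alpha> u"
proof -
  obtain z where z: "flat z = (\<Sum>c\<in>Basis. \<alpha> c *\<^sub>R c)"
    using linear_injective_imp_surjective[OF linear_flat inj_flat] by (metis surjD)
  have "b z c = \<alpha> c" if "c \<in> Basis" for c
    using flat_inner[OF that, of z] z that by simp
  then have "b z u = \<alpha> u" for u
    using nondegenerate_formD[OF b] \<alpha> linear_eq_on_Basis[of "b z" \<alpha>] by (simp add: bilinear_def)
  moreover from this have "sharp b \<alpha> = z" by (rule sharp_eqI)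
  ultimately show ?thesis by simp
qed

text \<open>A quantitative form of nondegeneracy. It survives small perturbations of
  \<open>b\<close>, up to the constant, and thereby gives uniform control near a point.\<close>

lemma form_bounded_below:
  obtains c where "c > 0" "\<And>v. c * norm v \<le> (\<Sum>u\<in>Basis. \<bar>b v u\<bar>)"
proof -
  obtain c where c: "c > 0" "\<And>v. c * norm v \<le> norm (flat v)"
    using linear_inj_bounded_below_pos[OF linear_flat inj_flat] by (metis mult.commute)
  show thesis
  proof (rule that[OF c(1)])
    fix v
    have "norm (flat v) \<le> (\<Sum>u\<in>Basis. norm (b v u *\<^sub>R u))" unfolding flat_def by (rule norm_sum)
    with c(2)[of v] show "c * norm v \<le> (\<Sum>u\<in>Basis. \<bar>b v u\<bar>)" by simp
  qed
qed

end

text \<open>The product rule for evaluating a varying functional at a varying vector. The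
  functionals are plain functions without a norm, so the rule is obtained from the expansion in
  basis vectors.\<close>

lemma linear_variable:
  fixes F :: "'a::euclidean_space \<Rightarrow> 'e::euclidean_space \<Rightarrow> real"
  assumes "open S" "x \<in> S" and F: "\<And>y. y \<in> S \<Longrightarrow> linear (F y)"
    and dF: "\<And>v. (\<lambda>y. F y v) differentiable (at x)" and X: "X differentiable (at x)"
  shows "(\<lambda>y. F y (X y)) differentiable (at x)"
    and "pderiv_along d (\<lambda>y. F y (X y)) x
      = pderiv_along d (\<lambda>y. F y (X x)) x + F x (pderiv_along d X x)"
proof -
  have Xb: "((\<lambda>y. X y \<bullet> b) has_derivative (\<lambda>d. pderiv_along d X x \<bullet> b)) (at x)" for b
    by (rule bounded_linear.has_derivative[OF bounded_linear_inner_left has_derivative_pderiv_along[OF X]])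
  have expand: "F y v = (\<Sum>b\<in>Basis. (v \<bullet> b) * F y b)" if "y \<in> S" for y v
    using linear_expand[OF F[OF that], of v] by simp
  have "((\<lambda>y. \<Sum>b\<in>Basis. (X y \<bullet> b) * F y b) has_derivative
      (\<lambda>d. \<Sum>b\<in>Basis. (X x \<bullet> b) * pderiv_along d (\<lambda>y. F y b) x + (pderiv_along d X x \<bullet> b) * F x b)) (at x)"
    by (intro has_derivative_sum has_derivative_mult Xb has_derivative_pderiv_along dF)
  then have *: "((\<lambda>y. F y (X y)) has_derivative
      (\<lambda>d. \<Sum>b\<in>Basis. (X x \<bullet> b) * pderiv_along d (\<lambda>y. F y b) x + (pderiv_along d X x \<bullet> b) * F x b)) (at x)"
    by (rule has_derivative_transform_within_open[OF _ assms(1,2)]) (rule expand[symmetric])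
  then show "(\<lambda>y. F y (X y)) differentiable (at x)" by (rule differentiableI)
  have "pderiv_along d (\<lambda>y. F y (X x)) x = pderiv_along d (\<lambda>y. \<Sum>b\<in>Basis. (X x \<bullet> b) * F y b) x"
    by (rule pderiv_along_cong[OF assms(1,2) expand])
  also have "\<dots> = (\<Sum>b\<in>Basis. (X x \<bullet> b) * pderiv_along d (\<lambda>y. F y b) x)"
    using dF by (simp add: pderiv_along_sum pderiv_along_mult)
  finally show "pderiv_along d (\<lambda>y. F y (X y)) x
      = pderiv_along d (\<lambda>y. F y (X x)) x + F x (pderiv_along d X x)"
    unfolding pderiv_along_eq[OF *]
    using expand[OF assms(2), of "pderiv_along d X x"] by (simp add: sum.distrib)
qed

lemma linear_bilinear_left: "bilinear b \<Longrightarrow> linear (\<lambda>v. b v w)"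
  and linear_bilinear_right: "bilinear b \<Longrightarrow> linear (b v)"
  by (simp_all add: bilinear_def)

lemma bilinear_variable:
  fixes F :: "'a::euclidean_space \<Rightarrow> 'e::euclidean_space \<Rightarrow> 'f::euclidean_space \<Rightarrow> real"
  assumes "open S" "x \<in> S" and F: "\<And>y. y \<in> S \<Longrightarrow> bilinear (F y)"
    and dF: "\<And>v w. (\<lambda>y. F y v w) differentiable (at x)"
    and X: "X differentiable (at x)" and Y: "Y differentiable (at x)"
  shows "pderiv_along d (\<lambda>y. F y (X y) (Y y)) x
    = pderiv_along d (\<lambda>y. F y (X x) (Y x)) x + F x (pderiv_along d X x) (Y x) + F x (X x) (pderiv_along d Y x)"
proof -
  have Y': "(\<lambda>y. F y v (Y y)) differentiable (at x)"
    "pderiv_along d (\<lambda>y. F y v (Y y)) x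
      = pderiv_along d (\<lambda>y. F y v (Y x)) x + F x v (pderiv_along d Y x)" for v
    using linear_variable[where F = "\<lambda>y. F y v", OF assms(1,2) linear_bilinear_right[OF F] dF Y]
    by simp_all
  have "pderiv_along d (\<lambda>y. F y (X y) (Y y)) x
      = pderiv_along d (\<lambda>y. F y (X x) (Y y)) x + F x (pderiv_along d X x) (Y x)"
    using linear_variable(2)[where F = "\<lambda>y v. F y v (Y y)",
        OF assms(1,2) linear_bilinear_left[OF F] Y'(1) X, of d]
    by simp
  then show ?thesis by (simp only: Y'(2))
qed

section \<open>Metrics on a coordinate domain and smoothness of raised indices\<close>

locale coordinate_metric =
  fixes G :: "'e::euclidean_space \<Rightarrow> 'e \<Rightarrow> 'e \<Rightarrow> real" and U :: "'e set"
  assumes open_U: "open U"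
    and nondegenerate: "x \<in> U \<Longrightarrow> nondegenerate_form (G x)"
    and symmetric: "x \<in> U \<Longrightarrow> G x v w = G x w v"
    and smooth: "smooth_on (\<lambda>x. G x v w) U"
begin

lemma bilinear: "x \<in> U \<Longrightarrow> bilinear (G x)"
  by (rule nondegenerate_formD[OF nondegenerate])

lemma differentiable: "x \<in> U \<Longrightarrow> (\<lambda>x. G x v w) differentiable (at x)"
  by (rule smooth_onD[OF smooth])

lemma expand_left: "x \<in> U \<Longrightarrow> G x v w = (\<Sum>b\<in>Basis. (v \<bullet> b) * G x b w)"
  using linear_expand[OF linear_bilinear_left[OF bilinear]] by simp

lemma expand_right: "x \<in> U \<Longrightarrow> G x v w = (\<Sum>b\<in>Basis. (w \<bullet> b) * G x v b)"
  using linear_expand[OF linear_bilinear_right[OF bilinear]] by simp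

lemma pderiv_along_expand_left:
  assumes "x \<in> U"
  shows "pderiv_along d (\<lambda>x. G x v w) x = (\<Sum>b\<in>Basis. (v \<bullet> b) * pderiv_along d (\<lambda>x. G x b w) x)"
proof -
  have "pderiv_along d (\<lambda>x. G x v w) x = pderiv_along d (\<lambda>x. \<Sum>b\<in>Basis. (v \<bullet> b) * G x b w) x"
    by (rule pderiv_along_cong[OF open_U assms expand_left])
  also have "\<dots> = (\<Sum>b\<in>Basis. (v \<bullet> b) * pderiv_along d (\<lambda>x. G x b w) x)"
    using differentiable[OF assms] by (simp add: pderiv_along_sum pderiv_along_mult)
  finally show ?thesis .
qed

lemma bilinear_pderiv_along:
  assumes "x \<in> U" shows "bilinear (\<lambda>v w. pderiv_along d (\<lambda>y. G y v w) x)"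
proof -
  have left: "linear (\<lambda>v. pderiv_along d (\<lambda>x. G x v w) x)" for w
    by (rule linear_sum_inner[THEN back_subst[of linear]])
      (rule ext, rule pderiv_along_expand_left[OF assms, symmetric])
  moreover have "linear (\<lambda>w. pderiv_along d (\<lambda>x. G x v w) x)" for v
  proof -
    have "pderiv_along d (\<lambda>x. G x v w) x = pderiv_along d (\<lambda>x. G x w v) x" for w
      by (rule pderiv_along_cong[OF open_U assms symmetric])
    then show ?thesis using left[of v] by simp
  qed
  ultimately show ?thesis by (simp add: bilinear_def)
qed

lemma form_variable:
  assumes "x \<in> U" "X differentiable (at x)"
  shows "(\<lambda>y. G y (X y) w) differentiable (at x)"
    and "pderiv_along d (\<lambda>y. G y (X y) w) x
      = pderiv_along d (\<lambda>y. G y (X x) w) x + G x (pderiv_along d X x) w"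
  using linear_variable[where F = "\<lambda>y v. G y v w",
      OF open_U assms(1) linear_bilinear_left[OF bilinear] differentiable[OF assms(1)] assms(2)]
  by simp_all

context
  fixes \<alpha> :: "'e \<Rightarrow> 'e \<Rightarrow> real"
  assumes lin: "x \<in> U \<Longrightarrow> linear (\<alpha> x)"
begin

text \<open>The lower bound at \<open>x\<close> persists nearby with half the constant: the change
  of \<open>G\<close> in its first argument is at most \<open>norm v\<close> times the total
  deviation \<open>D\<close> of its entries, and \<open>D\<close> tends to 0.\<close>

private lemma bounded_below_near:
  assumes "x \<in> U"
  obtains c where "c > 0" "\<forall>\<^sub>F y in at x. y \<in> U \<and> (\<forall>v. c * norm v \<le> (\<Sum>u\<in>Basis. \<bar>G y v u\<bar>))"
proof -
  obtain c where c: "c > 0" "\<And>v. c * norm v \<le> (\<Sum>u\<in>Basis. \<bar>G x v u\<bar>)"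
    using form_bounded_below[OF nondegenerate[OF assms]] by blast
  define D where "D y = (\<Sum>u\<in>Basis. \<Sum>b\<in>Basis. \<bar>G y b u - G x b u\<bar>)" for y
  have "((\<lambda>y. G y b u) \<longlongrightarrow> G x b u) (at x)" for b u
    using differentiable_imp_continuous_within[OF differentiable[OF assms]] by (simp add: continuous_within)
  then have "(D \<longlongrightarrow> (\<Sum>u\<in>Basis. \<Sum>b\<in>Basis. \<bar>G x b u - G x b u\<bar>)) (at x)"
    unfolding D_def by (intro tendsto_intros)
  then have "(D \<longlongrightarrow> 0) (at x)" by simp
  then have ev: "\<forall>\<^sub>F y in at x. D y < c / 2"
    using c(1) by (intro order_tendstoD) auto
  have evU: "\<forall>\<^sub>F y in at x. y \<in> U"
    using open_U assms eventually_at_topological by blast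
  have *: "c / 2 * norm v \<le> (\<Sum>u\<in>Basis. \<bar>G y v u\<bar>)" if "D y < c / 2" "y \<in> U" for y v
  proof -
    have "\<bar>G y v u - G x v u\<bar> \<le> norm v * (\<Sum>b\<in>Basis. \<bar>G y b u - G x b u\<bar>)" for u
    proof -
      have "G y v u - G x v u = (\<Sum>b\<in>Basis. (v \<bullet> b) * (G y b u - G x b u))"
        using expand_left[OF that(2), of v u] expand_left[OF assms, of v u]
        by (simp add: sum_subtractf right_diff_distrib)
      also have "\<bar>\<dots>\<bar> \<le> (\<Sum>b\<in>Basis. \<bar>v \<bullet> b\<bar> * \<bar>G y b u - G x b u\<bar>)"
        unfolding abs_mult[symmetric] by (rule sum_abs)
      also have "\<dots> \<le> (\<Sum>b\<in>Basis. norm v * \<bar>G y b u - G x b u\<bar>)"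
        by (intro sum_mono mult_right_mono) (auto simp: Basis_le_norm)
      finally show ?thesis by (simp add: sum_distrib_left)
    qed
    then have "(\<Sum>u\<in>Basis. \<bar>G y v u - G x v u\<bar>) \<le> norm v * D y"
      unfolding D_def sum_distrib_left[of "norm v" _ Basis] by (intro sum_mono) (simp add: sum_distrib_left)
    also have "\<dots> \<le> norm v * (c / 2)"
      using that by (intro mult_left_mono) auto
    finally have "(\<Sum>u\<in>Basis. \<bar>G y v u - G x v u\<bar>) \<le> norm v * (c / 2)" .
    moreover have "(\<Sum>u\<in>Basis. \<bar>G x v u\<bar>) \<le> (\<Sum>u\<in>Basis. \<bar>G y v u - G x v u\<bar>) + (\<Sum>u\<in>Basis. \<bar>G y v u\<bar>)"
      unfolding sum.distrib[symmetric] by (intro sum_mono) auto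
    ultimately show ?thesis using c(2)[of v] by (simp add: field_simps)
  qed
  show thesis
  proof (rule that[of "c / 2"])
    show "\<forall>\<^sub>F y in at x. y \<in> U \<and> (\<forall>v. c / 2 * norm v \<le> (\<Sum>u\<in>Basis. \<bar>G y v u\<bar>))"
      using eventually_conj[OF ev evU] by (rule eventually_mono) (use * in blast)
  qed (use c(1) in simp)
qed

text \<open>With \<open>z\<close> the raised field,
  \<open>G y (z y - z x) u = \<alpha> y u - G y (z x) u\<close>, and the right-hand side tends to 0.
  The locally uniform lower bound turns this into convergence of \<open>z y\<close>.\<close>

lemma isCont_sharp:
  assumes "x \<in> U" and \<alpha>: "\<And>u. isCont (\<lambda>y. \<alpha> y u) x"
  shows "isCont (\<lambda>y. sharp (G y) (\<alpha> y)) x"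
proof -
  let ?z = "\<lambda>y. sharp (G y) (\<alpha> y)"
  obtain c where c: "c > 0" "\<forall>\<^sub>F y in at x. y \<in> U \<and> (\<forall>v. c * norm v \<le> (\<Sum>u\<in>Basis. \<bar>G y v u\<bar>))"
    using bounded_below_near[OF assms(1)] by blast
  have "((\<lambda>y. G y (?z x) u) \<longlongrightarrow> G x (?z x) u) (at x)" for u
    using differentiable_imp_continuous_within[OF differentiable[OF assms(1)]] by (simp add: continuous_within)
  then have "((\<lambda>y. (\<Sum>u\<in>Basis. \<bar>\<alpha> y u - G y (?z x) u\<bar>) / c) \<longlongrightarrow> (\<Sum>u\<in>Basis. \<bar>\<alpha> x u - G x (?z x) u\<bar>) / c) (at x)"
    using \<alpha> c(1) by (intro tendsto_intros) (auto simp: continuous_within)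
  then have lim: "((\<lambda>y. (\<Sum>u\<in>Basis. \<bar>\<alpha> y u - G y (?z x) u\<bar>) / c) \<longlongrightarrow> 0) (at x)"
    using form_sharp[OF nondegenerate lin] assms(1) by simp
  have "\<forall>\<^sub>F y in at x. norm (?z y - ?z x) \<le> (\<Sum>u\<in>Basis. \<bar>\<alpha> y u - G y (?z x) u\<bar>) / c"
    using c(2)
  proof eventually_elim
    case (elim y)
    then have "c * norm (?z y - ?z x) \<le> (\<Sum>u\<in>Basis. \<bar>G y (?z y - ?z x) u\<bar>)" by blast
    also have "\<dots> = (\<Sum>u\<in>Basis. \<bar>\<alpha> y u - G y (?z x) u\<bar>)"
      using elim form_sharp[OF nondegenerate lin] by (simp add: bilinear_lsub[OF bilinear])
    finally show ?case using c(1) by (simp add: field_simps)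
  qed
  then have "((\<lambda>y. ?z y - ?z x) \<longlongrightarrow> 0) (at x)"
    by (rule Lim_null_comparison[OF _ lim])
  then show ?thesis by (simp add: isCont_def LIM_zero_cancel)
qed

text \<open>Let \<open>z y = sharp (G y) (\<alpha> y)\<close>. With \<open>x\<close> fixed, \<open>G x (z y) = \<alpha> y - (G y - G x) (z y)\<close>. The
  last term is a differentiable function vanishing at \<open>x\<close> times a merely continuous one, hence
  differentiable at \<open>x\<close>.\<close>

lemma differentiable_sharp:
  assumes "x \<in> U" and \<alpha>: "\<And>u. (\<lambda>y. \<alpha> y u) differentiable (at x)"
  shows "(\<lambda>y. sharp (G y) (\<alpha> y)) differentiable (at x)"
proof -
  let ?z = "\<lambda>y. sharp (G y) (\<alpha> y)"
  have cont: "isCont ?z x"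
    by (intro isCont_sharp assms(1) differentiable_imp_continuous_within \<alpha>)
  have vanishing: "(\<lambda>y. k y * l y) differentiable (at x)"
    if k: "k differentiable (at x)" "k x = 0" and l: "isCont l x" for k l :: "'e \<Rightarrow> real"
  proof -
    obtain k' where k': "(k has_derivative k') (at x)" using k(1) by (auto simp: differentiable_def)
    have bl: "bounded_linear k'" using k' by (rule has_derivative_bounded_linear)
    obtain K where K: "\<And>h. norm (k' h) \<le> norm h * K" using bounded_linear.bounded[OF bl] by blast
    have 1: "((\<lambda>y. norm (k y - k x - k' (y - x)) / norm (y - x) * \<bar>l y\<bar>) \<longlongrightarrow> 0 * \<bar>l x\<bar>) (at x)"
      using k' l by (intro tendsto_mult tendsto_rabs) (auto simp: has_derivative_iff_norm isCont_def)
    have 2: "((\<lambda>y. K * \<bar>l y - l x\<bar>) \<longlongrightarrow> K * \<bar>l x - l x\<bar>) (at x)"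
      using l by (intro tendsto_intros) (auto simp: isCont_def)
    have 3: "((\<lambda>y. norm (k y - k x - k' (y - x)) / norm (y - x) * \<bar>l y\<bar> + K * \<bar>l y - l x\<bar>) \<longlongrightarrow> 0) (at x)"
      using tendsto_add[OF 1 2] by simp
    have "((\<lambda>y. norm (k y * l y - k x * l x - k' (y - x) * l x) / norm (y - x)) \<longlongrightarrow> 0) (at x)"
    proof (rule Lim_null_comparison[OF _ 3], unfold eventually_at_filter, intro always_eventually allI)
      fix y show "y \<noteq> x \<longrightarrow> y \<in> UNIV \<longrightarrow> norm (norm (k y * l y - k x * l x - k' (y - x) * l x) / norm (y - x))
        \<le> norm (k y - k x - k' (y - x)) / norm (y - x) * \<bar>l y\<bar> + K * \<bar>l y - l x\<bar>"
      proof (intro impI)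
        assume "y \<noteq> x"
        have "k y * l y - k x * l x - k' (y - x) * l x = (k y - k x - k' (y - x)) * l y + k' (y - x) * (l y - l x)"
          using k(2) by (simp add: algebra_simps)
        then have "\<bar>k y * l y - k x * l x - k' (y - x) * l x\<bar> \<le> \<bar>k y - k x - k' (y - x)\<bar> * \<bar>l y\<bar> + \<bar>k' (y - x)\<bar> * \<bar>l y - l x\<bar>"
          by (metis abs_mult abs_triangle_ineq)
        also have "\<dots> \<le> \<bar>k y - k x - k' (y - x)\<bar> * \<bar>l y\<bar> + norm (y - x) * K * \<bar>l y - l x\<bar>"
          using K[of "y - x"] by (intro add_left_mono mult_right_mono) auto
        finally show "norm (norm (k y * l y - k x * l x - k' (y - x) * l x) / norm (y - x))
          \<le> norm (k y - k x - k' (y - x)) / norm (y - x) * \<bar>l y\<bar> + K * \<bar>l y - l x\<bar>"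
          using \<open>y \<noteq> x\<close> by (simp add: field_simps)
      qed
    qed
    moreover have "bounded_linear (\<lambda>h. k' h * l x)"
      by (rule bounded_linear_mult_const[OF bl])
    ultimately have "((\<lambda>y. k y * l y) has_derivative (\<lambda>h. k' h * l x)) (at x)"
      by (simp add: has_derivative_iff_norm)
    then show ?thesis by (rule differentiableI)
  qed
  \<comment> \<open>The basis dual to \<open>Basis\<close> with respect to \<open>G x\<close>: every
    vector \<open>z\<close> is the sum of the multiples \<open>G x z c\<close> of
    \<open>?s c\<close>.\<close>
  let ?s = "\<lambda>c. sharp (G x) (\<lambda>u. u \<bullet> c)"
  have s: "G x (?s c) u = u \<bullet> c" for c u
    by (intro form_sharp nondegenerate assms(1)) (simp add: linearI inner_add_left)
  have zr: "?z y = (\<Sum>c\<in>Basis. (\<alpha> y c - (\<Sum>b\<in>Basis. (G y b c - G x b c) * (?z y \<bullet> b))) *\<^sub>R ?s c)"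
    (is "_ = ?r y") if "y \<in> U" for y
  proof (rule form_eqI[OF nondegenerate[OF assms(1)]])
    fix u
    have "G x (?r y) u = (\<Sum>c\<in>Basis. (\<alpha> y c - (\<Sum>b\<in>Basis. (G y b c - G x b c) * (?z y \<bullet> b))) * (u \<bullet> c))"
      by (simp add: linear_sum[OF linear_bilinear_left[OF bilinear[OF assms(1)]]]
          linear_cmul[OF linear_bilinear_left[OF bilinear[OF assms(1)]]] s)
    also have "\<dots> = (\<Sum>c\<in>Basis. G x (?z y) c * (u \<bullet> c))"
    proof (rule sum.cong[OF refl])
      fix c :: 'e
      have "(\<Sum>b\<in>Basis. (G y b c - G x b c) * (?z y \<bullet> b)) = G y (?z y) c - G x (?z y) c"
        using expand_left[OF that, of "?z y" c] expand_left[OF assms(1), of "?z y" c]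
        by (simp add: sum_subtractf algebra_simps)
      moreover have "G y (?z y) c = \<alpha> y c"
        by (rule form_sharp[OF nondegenerate lin]) (use that in auto)
      ultimately show "(\<alpha> y c - (\<Sum>b\<in>Basis. (G y b c - G x b c) * (?z y \<bullet> b))) * (u \<bullet> c) = G x (?z y) c * (u \<bullet> c)"
        by simp
    qed
    also have "\<dots> = G x (?z y) u"
      using expand_right[OF assms(1), of "?z y" u] by (simp add: mult.commute)
    finally show "G x (?z y) u = G x (?r y) u" ..
  qed
  have eq: "?r y = ?z y" if "y \<in> U" for y using zr[OF that] by (rule sym)
  have "?r differentiable (at x)"
    using cont
    by (intro differentiable_sum differentiable_scaleR differentiable_diff vanishing \<alpha> differentiable
        differentiable_const assms(1) ballI)
      (auto intro!: continuous_intros)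
  then obtain D where "(?r has_derivative D) (at x)" unfolding differentiable_def ..
  then have "(?z has_derivative D) (at x)"
    by (rule has_derivative_transform_within_open[OF _ open_U assms(1)]) (rule eq)
  then show ?thesis by (rule differentiableI)
qed

text \<open>Differentiating the identity \<open>G y (z y) u = \<alpha> y u\<close> and solving for
  the derivative of \<open>z\<close>, which thus is a raised covector again.\<close>

lemma pderiv_along_sharp:
  assumes "x \<in> U" and \<alpha>: "\<And>u. (\<lambda>y. \<alpha> y u) differentiable (at x)"
  shows "pderiv_along d (\<lambda>y. sharp (G y) (\<alpha> y)) x
    = sharp (G x) (\<lambda>u. pderiv_along d (\<lambda>y. \<alpha> y u) x - pderiv_along d (\<lambda>y. G y (sharp (G x) (\<alpha> x)) u) x)"
proof (rule sharp_eqI[OF nondegenerate[OF assms(1)], symmetric])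
  fix u
  have "pderiv_along d (\<lambda>y. \<alpha> y u) x = pderiv_along d (\<lambda>y. G y (sharp (G y) (\<alpha> y)) u) x"
    by (rule pderiv_along_cong[OF open_U assms(1)]) (simp add: form_sharp[OF nondegenerate lin])
  with form_variable(2)[OF assms(1) differentiable_sharp[OF assms], of d u]
  show "G x (pderiv_along d (\<lambda>y. sharp (G y) (\<alpha> y)) x) u
    = pderiv_along d (\<lambda>y. \<alpha> y u) x - pderiv_along d (\<lambda>y. G y (sharp (G x) (\<alpha> x)) u) x"
    by simp
qed

end

text \<open>The derivative of a raised field is the raised field of \<open>?\<beta>\<close>, whose
  coefficients involve derivatives of \<alpha> and \<open>G\<close> and the raised field itself. All
  are of class C^k, the last by the induction hypothesis, which then applies to
  \<open>?\<beta>\<close> as well.\<close>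

lemma Ck_on_sharp:
  assumes "\<And>x. x \<in> U \<Longrightarrow> linear (\<alpha> x)" and "\<And>u. Ck_on k (\<lambda>x. \<alpha> x u) U"
  shows "Ck_on k (\<lambda>x. sharp (G x) (\<alpha> x)) U"
  using assms
proof (induction k arbitrary: \<alpha>)
  case 0
  then show ?case
    using open_U by (auto simp: continuous_on_eq_continuous_at intro!: isCont_sharp)
next
  case (Suc k)
  let ?z = "\<lambda>x. sharp (G x) (\<alpha> x)"
  have d\<alpha>: "(\<lambda>y. \<alpha> y u) differentiable (at x)" if "x \<in> U" for x u
    using Suc.prems(2) that by (simp add: Ck_on_Suc)
  have z: "Ck_on k ?z U"
    by (rule Suc.IH) (use Suc.prems(1) Ck_on_SucD[OF Suc.prems(2)] in auto)
  have dG: "Ck_on k (\<lambda>x. pderiv_along v (\<lambda>y. G y b u) x) U" for v b u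
    using smooth_on_pderiv_along[OF smooth] by (simp add: smooth_on_def)
  have "Ck_on k (pderiv_along v ?z) U" for v
  proof (rule Ck_on_cong[OF open_U Suc.IH])
    let ?\<beta> = "\<lambda>x u. pderiv_along v (\<lambda>y. \<alpha> y u) x - pderiv_along v (\<lambda>y. G y (?z x) u) x"
    show "sharp (G x) (?\<beta> x) = pderiv_along v ?z x" if "x \<in> U" for x
      using pderiv_along_sharp[where \<alpha>=\<alpha>] Suc.prems(1) that d\<alpha> by simp
    show "linear (?\<beta> x)" if "x \<in> U" for x
    proof (intro linear_compose_sub)
      show "linear (\<lambda>u. pderiv_along v (\<lambda>y. G y (?z x) u) x)"
        by (rule linear_bilinear_right[OF bilinear_pderiv_along[OF that]])
      have eq: "pderiv_along v (\<lambda>y. \<alpha> y u) x = (\<Sum>b\<in>Basis. (u \<bullet> b) * pderiv_along v (\<lambda>y. \<alpha> y b) x)" for u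
      proof -
        have "pderiv_along v (\<lambda>y. \<alpha> y u) x = pderiv_along v (\<lambda>y. \<Sum>b\<in>Basis. (u \<bullet> b) * \<alpha> y b) x"
          by (rule pderiv_along_cong[OF open_U that])
            (use linear_expand[OF Suc.prems(1), of _ u] in simp)
        then show ?thesis using d\<alpha>[OF that] by (simp add: pderiv_along_sum pderiv_along_mult)
      qed
      show "linear (\<lambda>u. pderiv_along v (\<lambda>y. \<alpha> y u) x)"
        by (rule linear_sum_inner[THEN back_subst[of linear]]) (rule ext, rule eq[symmetric])
    qed
    show "Ck_on k (\<lambda>x. ?\<beta> x u) U" for u
    proof -
      \<comment> \<open>In \<open>?\<beta>\<close> the vector \<open>?z x\<close> is frozen under
        the derivative of \<open>G\<close>. Expanding it in basis vectors gives products of its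
        coordinates with derivatives of fixed entries of \<open>G\<close>.\<close>
      have "Ck_on k (\<lambda>x. pderiv_along v (\<lambda>y. \<alpha> y u) x
          + (\<Sum>b\<in>Basis. ((- 1) * (?z x \<bullet> b)) * pderiv_along v (\<lambda>y. G y b u) x)) U"
        using Suc.prems(2)
        by (intro Ck_on_add Ck_on_sum Ck_on_mult Ck_on_const open_U dG
            Ck_on_bounded_bilinear[OF bounded_bilinear_inner] z) (simp add: Ck_on_Suc)
      then show ?thesis
        by (rule Ck_on_cong[OF open_U])
          (simp add: pderiv_along_expand_left[of _ v "?z _"] sum_negf)
    qed
  qed
  moreover have "?z differentiable (at x)" if "x \<in> U" for x
    using differentiable_sharp[where \<alpha>=\<alpha>] Suc.prems(1) that d\<alpha> by simp
  ultimately show ?case by (simp add: Ck_on_Suc)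
qed

lemma smooth_on_sharp:
  "(\<And>x. x \<in> U \<Longrightarrow> linear (\<alpha> x)) \<Longrightarrow> (\<And>u. smooth_on (\<lambda>x. \<alpha> x u) U) \<Longrightarrow>
    smooth_on (\<lambda>x. sharp (G x) (\<alpha> x)) U"
  by (simp add: smooth_on_def Ck_on_sharp)

end

section \<open>Levi-Civita connection in coordinates\<close>

definition gradient :: "('e::euclidean_space \<Rightarrow> 'e \<Rightarrow> 'e \<Rightarrow> real) \<Rightarrow> ('e \<Rightarrow> real) \<Rightarrow> 'e \<Rightarrow> 'e" where
  "gradient G u x = sharp (G x) (\<lambda>v. pderiv_along v u x)"

text \<open>\<open>Basis\<close> is orthonormal for the inner product, not for \<open>b\<close>: the
  sum is the trace of the endomorphism that \<open>b\<close> associates with \<open>H\<close>. The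
  scalar curvature is this trace of \<open>ricci\<close>.\<close>

definition metric_trace :: "('e::euclidean_space \<Rightarrow> 'e \<Rightarrow> real) \<Rightarrow> ('e \<Rightarrow> 'e \<Rightarrow> real) \<Rightarrow> real" where
  "metric_trace b H = (\<Sum>i\<in>Basis. sharp b (H i) \<bullet> i)"

definition laplacian :: "('e::euclidean_space \<Rightarrow> 'e \<Rightarrow> 'e \<Rightarrow> real) \<Rightarrow> ('e \<Rightarrow> real) \<Rightarrow> 'e \<Rightarrow> real" where
  "laplacian G u x = metric_trace (G x) (hessian G u x)"

lemma metric_trace_eq:
  "nondegenerate_form b \<Longrightarrow> (\<And>i u. H i u = b (Z i) u) \<Longrightarrow> metric_trace b H = (\<Sum>i\<in>Basis. Z i \<bullet> i)"
  by (simp add: metric_trace_def sharp_eqI)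

context coordinate_metric
begin

text \<open>Only for a linear functional is \<open>sharp\<close> known to deliver a representing
  vector, so this makes \<open>christoffel\<close> meaningful.\<close>

lemma linear_koszul:
  assumes "x \<in> U"
  shows "linear (\<lambda>u. (pderiv_along v (\<lambda>y. G y w u) x + pderiv_along w (\<lambda>y. G y v u) x
            - pderiv_along u (\<lambda>y. G y v w) x) / 2)"
proof -
  have "linear (\<lambda>u. (1/2) *\<^sub>R (pderiv_along v (\<lambda>y. G y w u) x + pderiv_along w (\<lambda>y. G y v u) x
            - pderiv_along u (\<lambda>y. G y v w) x))"
    using assms
    by (intro linear_compose_scale_right linear_compose_sub linear_compose_add
        linear_bilinear_right[OF bilinear_pderiv_along] linear_pderiv_along differentiable)
  then show ?thesis by simp
qed

lemma koszul:
  "x \<in> U \<Longrightarrow> G x (christoffel G x v w) u =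
    (pderiv_along v (\<lambda>y. G y w u) x + pderiv_along w (\<lambda>y. G y v u) x
            - pderiv_along u (\<lambda>y. G y v w) x) / 2"
  unfolding christoffel_def by (rule form_sharp[OF nondegenerate linear_koszul])

lemma pderiv_along_symmetric:
  "x \<in> U \<Longrightarrow> pderiv_along d (\<lambda>y. G y v w) x = pderiv_along d (\<lambda>y. G y w v) x"
  by (rule pderiv_along_cong[OF open_U _ symmetric])

lemma christoffel_eqI:
  assumes "x \<in> U"
    and "\<And>u. G x z u = (pderiv_along v (\<lambda>y. G y w u) x + pderiv_along w (\<lambda>y. G y v u) x
            - pderiv_along u (\<lambda>y. G y v w) x) / 2"
  shows "christoffel G x v w = z"
  unfolding christoffel_def by (rule sharp_eqI[OF nondegenerate[OF assms(1)] assms(2)])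

lemma christoffel_commute:
  assumes "x \<in> U" shows "christoffel G x v w = christoffel G x w v"
  by (rule christoffel_eqI[OF assms])
    (simp add: koszul[OF assms] pderiv_along_symmetric[OF assms, of _ v w])

lemma smooth_christoffel: "smooth_on (\<lambda>x. christoffel G x v w) U"
  unfolding christoffel_def
proof (rule smooth_on_sharp[OF linear_koszul])
  fix u
  have "smooth_on (\<lambda>x. (1/2) * (pderiv_along v (\<lambda>y. G y w u) x + pderiv_along w (\<lambda>y. G y v u) x
            - pderiv_along u (\<lambda>y. G y v w) x)) U"
    by (intro smooth_on_mult smooth_on_diff smooth_on_add smooth_on_const smooth_on_pderiv_along smooth open_U)
  then show "smooth_on (\<lambda>x. (pderiv_along v (\<lambda>y. G y w u) x + pderiv_along w (\<lambda>y. G y v u) x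
            - pderiv_along u (\<lambda>y. G y v w) x) / 2) U" by simp
qed

lemma linear_christoffel:
  assumes "x \<in> U" shows "linear (christoffel G x v)"
proof (rule linearI)
  note b = bilinear_pderiv_along[OF assms] and B = bilinear[OF assms]
    and p = linear_pderiv_along[OF differentiable[OF assms]]
  show "christoffel G x v (w + w') = christoffel G x v w + christoffel G x v w'" for w w'
    by (rule christoffel_eqI[OF assms])
      (simp add: bilinear_ladd[OF B] koszul[OF assms] bilinear_ladd[OF b] bilinear_radd[OF b] linear_add[OF p] field_simps)
  show "christoffel G x v (c *\<^sub>R w) = c *\<^sub>R christoffel G x v w" for c w
    by (rule christoffel_eqI[OF assms])
      (simp add: bilinear_lmul[OF B] koszul[OF assms] bilinear_lmul[OF b] bilinear_rmul[OF b] linear_cmul[OF p] field_simps)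
qed

lemma linear_riemann:
  assumes "x \<in> U" shows "linear (riemann G x u v)"
proof -
  have 1: "linear (\<lambda>w. pderiv_along u (\<lambda>y. christoffel G y v w) x)" for u v
  proof (rule linearI)
    note d = smooth_onD[OF smooth_christoffel assms]
    fix w w' and c :: real
    have "pderiv_along u (\<lambda>y. christoffel G y v (w + w')) x
      = pderiv_along u (\<lambda>y. christoffel G y v w + christoffel G y v w') x"
      by (rule pderiv_along_cong[OF open_U assms]) (rule linear_add[OF linear_christoffel])
    then show "pderiv_along u (\<lambda>y. christoffel G y v (w + w')) x
      = pderiv_along u (\<lambda>y. christoffel G y v w) x + pderiv_along u (\<lambda>y. christoffel G y v w') x"
      by (simp add: pderiv_along_add d)
    have "pderiv_along u (\<lambda>y. christoffel G y v (c *\<^sub>R w)) x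
      = pderiv_along u (\<lambda>y. c *\<^sub>R christoffel G y v w) x"
      by (rule pderiv_along_cong[OF open_U assms]) (rule linear_cmul[OF linear_christoffel])
    then show "pderiv_along u (\<lambda>y. christoffel G y v (c *\<^sub>R w)) x
      = c *\<^sub>R pderiv_along u (\<lambda>y. christoffel G y v w) x"
      by (simp add: pderiv_along_linear_compose[OF bounded_linear_scaleR_right] d)
  qed
  have 2: "linear (\<lambda>w. christoffel G x u (christoffel G x v w))" for u v
    using linear_compose[OF linear_christoffel linear_christoffel, OF assms assms] by (simp add: o_def)
  show ?thesis
    unfolding riemann_def[abs_def] by (intro linear_compose_add linear_compose_sub 1 2)
qed

text \<open>Needed for the \<open>sharp\<close> in the definition of the scalar curvature.\<close>

lemma linear_ricci:
  assumes "x \<in> U" shows "linear (ricci G x v)"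
  unfolding ricci_def[abs_def]
  using linear_compose[OF linear_riemann[OF assms] bounded_linear.linear[OF bounded_linear_inner_left]]
  by (intro linear_compose_sum ballI) (simp add: o_def)

lemma form_gradient:
  assumes "x \<in> U" "u differentiable (at x)"
  shows "G x (gradient G u x) v = pderiv_along v u x"
  unfolding gradient_def by (intro form_sharp nondegenerate linear_pderiv_along assms)

lemma smooth_gradient:
  assumes "smooth_on u U" shows "smooth_on (gradient G u) U"
  unfolding gradient_def[abs_def]
  using smooth_on_pderiv_along[OF assms] by (intro smooth_on_sharp linear_pderiv_along smooth_onD[OF assms]) simp

text \<open>Differentiate \<open>G(grad u, w) = D_w u\<close>. The terms without a second derivative
  match because the connection is compatible with the metric: adding the Koszul formulas for
  \<open>G(\<nabla>_v w, grad u)\<close> and \<open>G(\<nabla>_v grad u, w)\<close> leaves the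
  derivative of \<open>G\<close> along \<open>v\<close>.\<close>

lemma hessian_eq_gradient:
  assumes "x \<in> U" "smooth_on u U"
  shows "hessian G u x v w
    = G x (pderiv_along v (gradient G u) x + christoffel G x v (gradient G u x)) w"
proof -
  let ?g = "gradient G u"
  have "pderiv_along v (pderiv_along w u) x = pderiv_along v (\<lambda>y. G y (?g y) w) x"
    by (rule pderiv_along_cong[OF open_U assms(1)]) (simp add: form_gradient smooth_onD[OF assms(2)])
  also have "\<dots> = pderiv_along v (\<lambda>y. G y (?g x) w) x + G x (pderiv_along v ?g x) w"
    by (rule form_variable(2)[OF assms(1) smooth_onD[OF smooth_gradient[OF assms(2)] assms(1)]])
  finally have 1: "pderiv_along v (pderiv_along w u) x
    = pderiv_along v (\<lambda>y. G y (?g x) w) x + G x (pderiv_along v ?g x) w" .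
  have "pderiv_along (christoffel G x v w) u x = G x (christoffel G x v w) (?g x)"
    using symmetric[OF assms(1)] form_gradient[OF assms(1) smooth_onD[OF assms(2,1)]] by metis
  then have "pderiv_along (christoffel G x v w) u x + G x (christoffel G x v (?g x)) w
    = pderiv_along v (\<lambda>y. G y (?g x) w) x"
    using pderiv_along_symmetric[OF assms(1), of v w "?g x"]
     pderiv_along_symmetric[OF assms(1), of w v "?g x"]
     pderiv_along_symmetric[OF assms(1), of "?g x" w v]
    by (simp add: koszul[OF assms(1)] field_simps)
  with 1 show ?thesis
    by (simp add: hessian_def bilinear_ladd[OF bilinear[OF assms(1)]])
qed

text \<open>The endomorphism \<open>v \<mapsto> \<nabla>_v grad u\<close> represents the Hessian, so
  the Laplacian is its trace. This is the shape in which the Laplacian arises when the curvature of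
  the product is traced.\<close>

lemma laplacian_eq_divergence:
  assumes "x \<in> U" "smooth_on u U"
  shows "laplacian G u x
    = (\<Sum>b\<in>Basis. (pderiv_along b (gradient G u) x + christoffel G x b (gradient G u x)) \<bullet> b)"
  unfolding laplacian_def
  by (rule metric_trace_eq[OF nondegenerate[OF assms(1)] hessian_eq_gradient[OF assms]])

text \<open>With \<open>X\<close> the gradient of \<open>u\<close> this is smoothness of the square
  of the gradient.\<close>

lemma smooth_pderiv_along_variable:
  fixes u :: "'e \<Rightarrow> real"
  assumes "smooth_on u U" "smooth_on X U"
  shows "smooth_on (\<lambda>x. pderiv_along (X x) u x) U"
proof -
  have "smooth_on (\<lambda>x. \<Sum>b\<in>Basis. (X x \<bullet> b) * pderiv_along b u x) U"
    using assms by (intro smooth_on_sum smooth_on_mult smooth_on_inner smooth_on_const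
        smooth_on_pderiv_along open_U)
  then show ?thesis
    by (rule smooth_on_cong[OF open_U])
      (use linear_expand[OF linear_pderiv_along[OF smooth_onD[OF assms(1)]]] in simp)
qed

lemma smooth_laplacian:
  fixes u :: "'e \<Rightarrow> real"
  assumes "smooth_on u U" shows "smooth_on (laplacian G u) U"
proof -
  note g = smooth_gradient[OF assms]
  have "smooth_on (\<lambda>x. \<Sum>b\<in>Basis. (pderiv_along b (gradient G u) x
      + (\<Sum>c\<in>Basis. (gradient G u x \<bullet> c) *\<^sub>R christoffel G x b c)) \<bullet> b) U"
    using g by (intro smooth_on_sum smooth_on_inner smooth_on_add smooth_on_const smooth_on_scaleR
        smooth_on_pderiv_along smooth_christoffel open_U)
  then show ?thesis
    by (rule smooth_on_cong[OF open_U])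
     (simp add: laplacian_eq_divergence assms linear_expand[OF linear_christoffel, of _ _ "gradient G u _", symmetric])
qed

end

text \<open>This and the two lemmas after it express locality. The components of the warped metric
  are known to agree with \<open>warped_form\<close> on the chart domain only, which suffices since
  it is open.\<close>

lemma christoffel_cong:
  assumes "open S" "x \<in> S" "\<And>y. y \<in> S \<Longrightarrow> G y = G' y"
  shows "christoffel G x v w = christoffel G' x v w"
proof -
  have "pderiv_along v (\<lambda>y. G y w u) x = pderiv_along v (\<lambda>y. G' y w u) x" for v w u
    by (rule pderiv_along_cong[OF assms(1,2)]) (simp add: assms(3))
  then show ?thesis by (simp add: christoffel_def assms(2,3))
qed

lemma hessian_cong:
  assumes "open S" "x \<in> S" "\<And>y. y \<in> S \<Longrightarrow> G y = G' y" "\<And>y. y \<in> S \<Longrightarrow> u y = u' y"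
  shows "hessian G u x v w = hessian G' u' x v w"
proof -
  have "pderiv_along v u y = pderiv_along v u' y" if "y \<in> S" for v y
    by (rule pderiv_along_cong[OF assms(1) that assms(4)])
  moreover from this have "pderiv_along v (pderiv_along w u) x = pderiv_along v (pderiv_along w u') x"
    by (intro pderiv_along_cong[OF assms(1,2)])
  ultimately show ?thesis
    using assms(2) by (simp add: hessian_def christoffel_cong[OF assms(1-3)])
qed

lemma scalar_curvature_cong:
  assumes "open S" "x \<in> S" "\<And>y. y \<in> S \<Longrightarrow> G y = G' y"
  shows "scalar_curvature G x = scalar_curvature G' x"
proof -
  have c: "christoffel G y = christoffel G' y" if "y \<in> S" for y
    by (intro ext christoffel_cong[OF assms(1) that assms(3)])
  have "pderiv_along u (\<lambda>y. christoffel G y v w) x = pderiv_along u (\<lambda>y. christoffel G' y v w) x" for u v w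
    by (rule pderiv_along_cong[OF assms(1,2)]) (simp add: c)
  then have "riemann G x u v w = riemann G' x u v w" for u v w
    by (simp add: riemann_def c assms(2))
  then show ?thesis by (simp add: scalar_curvature_def ricci_def[abs_def] assms(2,3))
qed

section \<open>Traces and changes of coordinates\<close>

lemma trace_commute:
  fixes P :: "'e::euclidean_space \<Rightarrow> 'f::euclidean_space" and Q :: "'f \<Rightarrow> 'e"
  assumes "linear P" "linear Q"
  shows "(\<Sum>b\<in>Basis. Q (P b) \<bullet> b) = (\<Sum>c\<in>Basis. P (Q c) \<bullet> c)"
proof -
  have "(\<Sum>b\<in>Basis. Q (P b) \<bullet> b) = (\<Sum>b\<in>Basis. \<Sum>c\<in>Basis. (P b \<bullet> c) * (Q c \<bullet> b))"
    by (subst linear_expand[OF assms(2)]) (simp add: inner_sum_left)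
  also have "\<dots> = (\<Sum>c\<in>Basis. \<Sum>b\<in>Basis. (Q c \<bullet> b) * (P b \<bullet> c))"
    by (subst sum.swap) (simp add: mult.commute)
  also have "\<dots> = (\<Sum>c\<in>Basis. P (Q c) \<bullet> c)"
    by (subst linear_expand[OF assms(1)]) (simp add: inner_sum_left)
  finally show ?thesis .
qed

text \<open>With the inverse \<open>R\<close> of \<open>L\<close>, \<open>Z\<close> is
  \<open>R o Z' o L\<close>, and the trace is cyclic.\<close>

lemma trace_conjugate:
  fixes L Z Z' :: "'e::euclidean_space \<Rightarrow> 'e"
  assumes L: "linear L" "surj L" and Z': "linear Z'" and eq: "\<And>v. L (Z v) = Z' (L v)"
  shows "(\<Sum>b\<in>Basis. Z b \<bullet> b) = (\<Sum>b\<in>Basis. Z' b \<bullet> b)"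
proof -
  obtain R where R: "linear R" "\<And>v. R (L v) = v" "\<And>v. L (R v) = v"
    using linear_surjective_isomorphism[OF L] by metis
  have "(\<Sum>b\<in>Basis. Z b \<bullet> b) = (\<Sum>b\<in>Basis. R ((Z' \<circ> L) b) \<bullet> b)"
    using R(2) by (simp flip: eq)
  also have "\<dots> = (\<Sum>b\<in>Basis. (Z' \<circ> L) (R b) \<bullet> b)"
    by (rule trace_commute[OF linear_compose[OF L(1) Z'] R(1)])
  finally show ?thesis by (simp add: R(3))
qed

text \<open>The second derivative of the transition map \<open>T\<close> enters the Christoffel symbols and drops out
  of the Hessian, because it is symmetric.\<close>

locale coordinate_change =
  G: coordinate_metric G U + G': coordinate_metric G' U'
  for G :: "'e::euclidean_space \<Rightarrow> 'e \<Rightarrow> 'e \<Rightarrow> real" and U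
    and G' :: "'e \<Rightarrow> 'e \<Rightarrow> 'e \<Rightarrow> real" and U' +
  fixes T :: "'e \<Rightarrow> 'e" and S :: "'e set"
  assumes open_S: "open S" and S_U: "S \<subseteq> U" and T_U': "T ` S \<subseteq> U'"
    and smooth_T: "smooth_on T S"
    and surj_T: "x \<in> S \<Longrightarrow> surj (\<lambda>v. pderiv_along v T x)"
    and pullback: "x \<in> S \<Longrightarrow> G x v w = G' (T x) (pderiv_along v T x) (pderiv_along w T x)"
begin

lemma linear_T: "x \<in> S \<Longrightarrow> linear (\<lambda>v. pderiv_along v T x)"
  by (rule linear_pderiv_along[OF smooth_onD[OF smooth_T]])

text \<open>Images under the derivative of \<open>T\<close> are enough as test vectors, because that
  derivative is surjective.\<close>

lemma vector_eqI:
  assumes "x \<in> S" "\<And>u. G' (T x) z (pderiv_along u T x) = G' (T x) z' (pderiv_along u T x)"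
  shows "z = z'"
proof (rule form_eqI[OF G'.nondegenerate])
  show "T x \<in> U'" using assms(1) T_U' by blast
  show "G' (T x) z u = G' (T x) z' u" for u
    using surjD[OF surj_T[OF assms(1)], of u] assms(2) by auto
qed

lemma compose_T:
  assumes "x \<in> S" "u differentiable (at (T x))"
  shows "(\<lambda>y. u (T y)) differentiable (at x)"
    and "pderiv_along v (\<lambda>y. u (T y)) x = pderiv_along (pderiv_along v T x) u (T x)"
proof -
  note T = has_derivative_pderiv_along[OF smooth_onD[OF smooth_T assms(1)]]
  show "(\<lambda>y. u (T y)) differentiable (at x)"
    using has_derivative_compose[OF T has_derivative_pderiv_along[OF assms(2)]] by (rule differentiableI)
  show "pderiv_along v (\<lambda>y. u (T y)) x = pderiv_along (pderiv_along v T x) u (T x)"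
    by (rule pderiv_along_compose[OF T assms(2)])
qed

lemma pderiv_along_pullback:
  assumes "x \<in> S"
  shows "pderiv_along a (\<lambda>y. G y b c) x
    = pderiv_along (pderiv_along a T x) (\<lambda>y. G' y (pderiv_along b T x) (pderiv_along c T x)) (T x)
      + G' (T x) (pderiv_along a (pderiv_along b T) x) (pderiv_along c T x)
      + G' (T x) (pderiv_along b T x) (pderiv_along a (pderiv_along c T) x)"
proof -
  have Tx: "T y \<in> U'" if "y \<in> S" for y using that T_U' by blast
  note d = G'.differentiable[OF Tx[OF assms]]
  have "pderiv_along a (\<lambda>y. G y b c) x = pderiv_along a (\<lambda>y. G' (T y) (pderiv_along b T y) (pderiv_along c T y)) x"
    by (rule pderiv_along_cong[OF open_S assms pullback])
  also have "\<dots> = pderiv_along a (\<lambda>y. G' (T y) (pderiv_along b T x) (pderiv_along c T x)) x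
      + G' (T x) (pderiv_along a (pderiv_along b T) x) (pderiv_along c T x)
      + G' (T x) (pderiv_along b T x) (pderiv_along a (pderiv_along c T) x)"
    by (rule bilinear_variable[OF open_S assms G'.bilinear[OF Tx] compose_T(1)[OF assms d]])
      (simp_all add: smooth_onD[OF smooth_on_pderiv_along[OF smooth_T] assms])
  finally show ?thesis by (simp add: compose_T(2)[OF assms d])
qed

text \<open>The Koszul formula acquires six terms with second derivatives of \<open>T\<close>. By
  their symmetry four cancel, and the other two coincide and absorb the division by 2.\<close>

lemma christoffel_transform:
  assumes "x \<in> S"
  shows "pderiv_along (christoffel G x v w) T x
    = christoffel G' (T x) (pderiv_along v T x) (pderiv_along w T x) + pderiv_along v (pderiv_along w T) x"
    (is "?L (christoffel G x v w) = ?\<Gamma> + ?Q v w")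
proof (rule vector_eqI[OF assms])
  fix u
  have Tx: "T x \<in> U'" and x: "x \<in> U" using assms T_U' S_U by auto
  note Q = pderiv_along_commute[OF open_S assms smooth_T]
  have "G' (T x) (?L (christoffel G x v w)) (?L u) = G x (christoffel G x v w) u"
    by (rule pullback[OF assms, symmetric])
  also have "\<dots> = G' (T x) ?\<Gamma> (?L u) + G' (T x) (?Q v w) (?L u)"
    unfolding G.koszul[OF x] G'.koszul[OF Tx] pderiv_along_pullback[OF assms]
    using G'.symmetric[OF Tx, of "?L w" "?Q v u"] G'.symmetric[OF Tx, of "?L v" "?Q w u"]
      G'.symmetric[OF Tx, of "?Q u v" "?L w"] Q[of u v] Q[of u w] Q[of w v]
    by (simp add: field_simps)
  finally show "G' (T x) (?L (christoffel G x v w)) (?L u) = G' (T x) (?\<Gamma> + ?Q v w) (?L u)"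
    by (simp add: bilinear_ladd[OF G'.bilinear[OF Tx]])
qed

context
  fixes u u' :: "'e \<Rightarrow> real"
  assumes u: "smooth_on u U" and u': "smooth_on u' U'" and uu': "x \<in> S \<Longrightarrow> u x = u' (T x)"
begin

lemma pderiv_along_transform:
  assumes "x \<in> S" shows "pderiv_along v u x = pderiv_along (pderiv_along v T x) u' (T x)"
proof -
  have "pderiv_along v u x = pderiv_along v (\<lambda>y. u' (T y)) x"
    by (rule pderiv_along_cong[OF open_S assms uu'])
  also have "\<dots> = pderiv_along (pderiv_along v T x) u' (T x)"
    using assms T_U' by (intro compose_T(2) smooth_onD[OF u']) auto
  finally show ?thesis .
qed

lemma hessian_transform:
  assumes "x \<in> S"
  shows "hessian G u x v w = hessian G' u' (T x) (pderiv_along v T x) (pderiv_along w T x)"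
proof -
  have Tx: "T y \<in> U'" if "y \<in> S" for y using that T_U' by blast
  have "pderiv_along v (pderiv_along w u) x
    = pderiv_along v (\<lambda>y. pderiv_along (pderiv_along w T y) u' (T y)) x"
    by (rule pderiv_along_cong[OF open_S assms pderiv_along_transform])
  also have "\<dots> = pderiv_along v (\<lambda>y. pderiv_along (pderiv_along w T x) u' (T y)) x
      + pderiv_along (pderiv_along v (pderiv_along w T) x) u' (T x)"
    by (rule linear_variable(2)[OF open_S assms])
      (auto intro!: linear_pderiv_along smooth_onD[OF u'] Tx compose_T(1) assms
        smooth_onD[OF smooth_on_pderiv_along[OF u']] smooth_onD[OF smooth_on_pderiv_along[OF smooth_T]])
  also have "pderiv_along v (\<lambda>y. pderiv_along (pderiv_along w T x) u' (T y)) x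
    = pderiv_along (pderiv_along v T x) (pderiv_along (pderiv_along w T x) u') (T x)"
    by (rule compose_T(2)[OF assms smooth_onD[OF smooth_on_pderiv_along[OF u'] Tx[OF assms]]])
  finally show ?thesis
    by (simp add: hessian_def pderiv_along_transform[OF assms] christoffel_transform[OF assms]
        linear_add[OF linear_pderiv_along[OF smooth_onD[OF u' Tx[OF assms]]]])
qed

text \<open>The derivative of \<open>T\<close> carries one gradient to the other, since both
  represent the differential of the same function.\<close>

lemma gradient_norm_transform:
  assumes "x \<in> S"
  shows "pderiv_along (gradient G u x) u x = pderiv_along (gradient G' u' (T x)) u' (T x)"
proof -
  have Tx: "T x \<in> U'" and x: "x \<in> U" using assms T_U' S_U by auto
  have "pderiv_along (gradient G u x) T x = gradient G' u' (T x)"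
    by (rule vector_eqI[OF assms])
      (simp add: pullback[OF assms, symmetric] G.form_gradient[OF x smooth_onD[OF u x]]
        G'.form_gradient[OF Tx smooth_onD[OF u' Tx]] pderiv_along_transform[OF assms])
  then show ?thesis by (simp add: pderiv_along_transform[OF assms])
qed

text \<open>By \<open>hessian_transform\<close>, the derivative of \<open>T\<close> intertwines the
  endomorphisms \<open>?Z\<close> and \<open>?Z'\<close> that represent the Hessian, so they have
  the same trace.\<close>

lemma laplacian_transform:
  assumes "x \<in> S"
  shows "laplacian G u x = laplacian G' u' (T x)"
proof -
  have Tx: "T x \<in> U'" and x: "x \<in> U" using assms T_U' S_U by auto
  let ?Z = "\<lambda>v. pderiv_along v (gradient G u) x + christoffel G x v (gradient G u x)"
  let ?Z' = "\<lambda>v. pderiv_along v (gradient G' u') (T x) + christoffel G' (T x) v (gradient G' u' (T x))"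
  have "(\<Sum>b\<in>Basis. ?Z b \<bullet> b) = (\<Sum>b\<in>Basis. ?Z' b \<bullet> b)"
  proof (rule trace_conjugate[OF linear_T[OF assms] surj_T[OF assms]])
    show "linear ?Z'"
      unfolding G'.christoffel_commute[OF Tx, of _ "gradient G' u' (T x)"]
      by (intro linear_compose_add linear_pderiv_along G'.linear_christoffel Tx
          smooth_onD[OF G'.smooth_gradient[OF u'] Tx])
    show "pderiv_along (?Z v) T x = ?Z' (pderiv_along v T x)" for v
      by (rule vector_eqI[OF assms])
        (simp only: pullback[OF assms, symmetric] G.hessian_eq_gradient[OF x u, symmetric]
          G'.hessian_eq_gradient[OF Tx u', symmetric] hessian_transform[OF assms])
  qed
  then show ?thesis
    by (simp add: G.laplacian_eq_divergence[OF x u] G'.laplacian_eq_divergence[OF Tx u'])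
qed

end

end

section \<open>Curvature of a warped product in coordinates\<close>

definition warped_form ::
  "('e::euclidean_space \<Rightarrow> 'e \<Rightarrow> 'e \<Rightarrow> real) \<Rightarrow> ('e \<Rightarrow> real) \<Rightarrow>
   ('f::euclidean_space \<Rightarrow> 'f \<Rightarrow> 'f \<Rightarrow> real) \<Rightarrow> 'e \<times> 'f \<Rightarrow> 'e \<times> 'f \<Rightarrow> 'e \<times> 'f \<Rightarrow> real" where
  "warped_form A \<phi> C z v w =
     A (fst z) (fst v) (fst w) + (\<phi> (fst z))\<^sup>2 * C (snd z) (snd v) (snd w)"

lemma sum_Basis_prod:
  "(\<Sum>b\<in>Basis. k b) = (\<Sum>b\<in>Basis. k (b, 0)) + (\<Sum>b\<in>Basis. k (0, b))"
  for k :: "'e::euclidean_space \<times> 'f::euclidean_space \<Rightarrow> 'c::comm_monoid_add"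
proof -
  have "inj_on (\<lambda>u::'e. (u, 0::'f)) Basis" "inj_on (\<lambda>u::'f. (0::'e, u)) Basis"
    by (auto intro!: inj_onI)
  then show ?thesis
    unfolding Basis_prod_def by (subst sum.union_disjoint) (auto simp: sum.reindex)
qed

lemma pderiv_along_fst:
  assumes "u differentiable (at (fst z))"
  shows "(\<lambda>z. u (fst z)) differentiable (at z)"
    and "pderiv_along v (\<lambda>z. u (fst z)) z = pderiv_along (fst v) u (fst z)"
proof -
  have d: "(fst has_derivative fst) (at z)"
    by (rule bounded_linear_imp_has_derivative[OF bounded_linear_fst])
  show "(\<lambda>z. u (fst z)) differentiable (at z)"
    using has_derivative_compose[OF d has_derivative_pderiv_along[OF assms]] by (rule differentiableI)
  show "pderiv_along v (\<lambda>z. u (fst z)) z = pderiv_along (fst v) u (fst z)"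
    by (rule pderiv_along_compose[OF d assms])
qed

lemma pderiv_along_snd:
  assumes "u differentiable (at (snd z))"
  shows "(\<lambda>z. u (snd z)) differentiable (at z)"
    and "pderiv_along v (\<lambda>z. u (snd z)) z = pderiv_along (snd v) u (snd z)"
proof -
  have d: "(snd has_derivative snd) (at z)"
    by (rule bounded_linear_imp_has_derivative[OF bounded_linear_snd])
  show "(\<lambda>z. u (snd z)) differentiable (at z)"
    using has_derivative_compose[OF d has_derivative_pderiv_along[OF assms]] by (rule differentiableI)
  show "pderiv_along v (\<lambda>z. u (snd z)) z = pderiv_along (snd v) u (snd z)"
    by (rule pderiv_along_compose[OF d assms])
qed

lemma pderiv_along_Pair:
  assumes "P differentiable (at z)" "Q differentiable (at z)"
  shows "pderiv_along v (\<lambda>z. (P z, Q z)) z = (pderiv_along v P z, pderiv_along v Q z)"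
  by (rule pderiv_along_eq) (intro has_derivative_Pair has_derivative_pderiv_along assms)

locale warped_coordinates =
  A: coordinate_metric A U + C: coordinate_metric C V
  for A :: "'e::euclidean_space \<Rightarrow> 'e \<Rightarrow> 'e \<Rightarrow> real" and U
    and C :: "'f::euclidean_space \<Rightarrow> 'f \<Rightarrow> 'f \<Rightarrow> real" and V +
  fixes \<phi> :: "'e \<Rightarrow> real"
  assumes smooth_\<phi>: "smooth_on \<phi> U" and positive: "x \<in> U \<Longrightarrow> \<phi> x > 0"
begin

abbreviation W :: "'e \<times> 'f \<Rightarrow> 'e \<times> 'f \<Rightarrow> 'e \<times> 'f \<Rightarrow> real" where
  "W \<equiv> warped_form A \<phi> C"

lemma open_UV: "open (U \<times> V)"
  by (rule open_Times[OF A.open_U C.open_U])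

lemma nondegenerate_warped_form:
  assumes "x \<in> U" "y \<in> V" shows "nondegenerate_form (W (x, y))"
proof -
  note a = A.bilinear[OF assms(1)] and c = C.bilinear[OF assms(2)]
  have "bilinear (W (x, y))"
    unfolding bilinear_def
    by (auto intro!: linearI simp: warped_form_def bilinear_ladd[OF a] bilinear_ladd[OF c]
        bilinear_radd[OF a] bilinear_radd[OF c] bilinear_lmul[OF a] bilinear_lmul[OF c]
        bilinear_rmul[OF a] bilinear_rmul[OF c] algebra_simps)
  moreover have "v = 0" if "\<forall>w. W (x, y) v w = 0" for v
  proof -
    have "A x (fst v) w = 0" for w
      using that[rule_format, of "(w, 0)"] by (simp add: warped_form_def bilinear_rzero[OF c])
    moreover have "C y (snd v) w = 0" for w
      using that[rule_format, of "(0, w)"] positive[OF assms(1)]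
      by (simp add: warped_form_def bilinear_rzero[OF a])
    ultimately show ?thesis
      using A.nondegenerate[OF assms(1)] C.nondegenerate[OF assms(2)]
      by (auto simp: nondegenerate_form_def prod_eq_iff)
  qed
  ultimately show ?thesis by (auto simp: nondegenerate_form_def)
qed

sublocale W: coordinate_metric W "U \<times> V"
proof
  show "open (U \<times> V)" by (rule open_UV)
  show "nondegenerate_form (W z)" if "z \<in> U \<times> V" for z
    using that nondegenerate_warped_form by auto
  show "W z v w = W z w v" if "z \<in> U \<times> V" for z v w
    using that A.symmetric C.symmetric by (auto simp: warped_form_def)
  show "smooth_on (\<lambda>z. W z v w) (U \<times> V)" for v w
    unfolding warped_form_def power2_eq_square
    by (intro smooth_on_add smooth_on_mult open_UV smooth_on_linear_compose[where L = fst and S' = U]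
        smooth_on_linear_compose[where L = snd and S' = V] smooth_\<phi> A.smooth C.smooth
        bounded_linear.linear bounded_linear_fst bounded_linear_snd) auto
qed

context
  fixes x y assumes x: "x \<in> U" and y: "y \<in> V"
begin

private lemma xy: "(x, y) \<in> U \<times> V" using x y by simp

private lemma d\<phi>: "\<phi> differentiable (at x)" by (rule smooth_onD[OF smooth_\<phi> x])

private lemma \<phi>_nz: "\<phi> x \<noteq> 0" using positive[OF x] by simp

lemma pderiv_along_warped_form:
  "pderiv_along d (\<lambda>z. W z v w) (x, y) =
    pderiv_along (fst d) (\<lambda>x. A x (fst v) (fst w)) x
    + 2 * \<phi> x * pderiv_along (fst d) \<phi> x * C y (snd v) (snd w)
    + (\<phi> x)\<^sup>2 * pderiv_along (snd d) (\<lambda>y. C y (snd v) (snd w)) y"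
proof -
  have a: "(\<lambda>x. A x (fst v) (fst w)) differentiable (at (fst (x, y)))" by (simp add: A.differentiable x)
  have c: "(\<lambda>y. C y (snd v) (snd w)) differentiable (at (snd (x, y)))" by (simp add: C.differentiable y)
  have p: "\<phi> differentiable (at (fst (x, y)))" by (simp add: d\<phi>)
  note da = pderiv_along_fst[OF a] and dc = pderiv_along_snd[OF c] and dp = pderiv_along_fst[OF p]
  have pp: "(\<lambda>z. \<phi> (fst z) * \<phi> (fst z)) differentiable (at (x, y))"
    by (rule differentiable_mult[OF dp(1) dp(1)])
  show ?thesis
    unfolding warped_form_def power2_eq_square
    unfolding pderiv_along_add[OF da(1) differentiable_mult[OF pp dc(1)]]
      pderiv_along_mult[OF pp dc(1)] pderiv_along_mult[OF dp(1) dp(1)] da(2) dc(2) dp(2)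
    by (simp add: algebra_simps)
qed

text \<open>Verified by the Koszul formula. The familiar normal term is
  \<open>-<v,w> / \<phi>\<close> times the gradient; here \<open><v,w>\<close> is
  \<open>\<phi>^2 C(v,w)\<close> on fiber vectors, which leaves the factor
  \<open>C(v,w) \<phi>\<close>. The gradient is that of the base metric.\<close>

lemma christoffel_warped:
  "christoffel W (x, y) v w =
    (christoffel A x (fst v) (fst w) - (C y (snd v) (snd w) * \<phi> x) *\<^sub>R gradient A \<phi> x,
     christoffel C y (snd v) (snd w) + (pderiv_along (fst v) \<phi> x / \<phi> x) *\<^sub>R snd w
       + (pderiv_along (fst w) \<phi> x / \<phi> x) *\<^sub>R snd v)"
proof (rule W.christoffel_eqI[OF xy])
  note a = A.bilinear[OF x] and c = C.bilinear[OF y]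
  fix u
  show "W (x, y) (christoffel A x (fst v) (fst w) - (C y (snd v) (snd w) * \<phi> x) *\<^sub>R gradient A \<phi> x,
     christoffel C y (snd v) (snd w) + (pderiv_along (fst v) \<phi> x / \<phi> x) *\<^sub>R snd w
       + (pderiv_along (fst w) \<phi> x / \<phi> x) *\<^sub>R snd v) u
    = (pderiv_along v (\<lambda>z. W z w u) (x, y) + pderiv_along w (\<lambda>z. W z v u) (x, y)
       - pderiv_along u (\<lambda>z. W z v w) (x, y)) / 2"
    unfolding pderiv_along_warped_form using \<phi>_nz
    by (simp add: warped_form_def bilinear_lsub[OF a] bilinear_ladd[OF c] bilinear_lmul[OF a]
        bilinear_lmul[OF c] A.koszul[OF x] C.koszul[OF y] A.form_gradient[OF x d\<phi>]
        field_simps power2_eq_square)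
qed

text \<open>A sum \<open>h1 + h2\<close> has no mixed second derivatives, so whatever exceeds the
  Hessians of the factors comes from the extra terms of the connection.\<close>

lemma hessian_warped:
  fixes h1 :: "'e \<Rightarrow> real" and h2 :: "'f \<Rightarrow> real"
  assumes h1: "smooth_on h1 U" and h2: "smooth_on h2 V"
  shows "hessian W (\<lambda>z. h1 (fst z) + h2 (snd z)) (x, y) v w =
    hessian A h1 x (fst v) (fst w) + hessian C h2 y (snd v) (snd w)
    + C y (snd v) (snd w) * \<phi> x * pderiv_along (gradient A \<phi> x) h1 x
    - pderiv_along (fst v) \<phi> x / \<phi> x * pderiv_along (snd w) h2 y
    - pderiv_along (fst w) \<phi> x / \<phi> x * pderiv_along (snd v) h2 y"
proof -
  let ?h = "\<lambda>z. h1 (fst z) + h2 (snd z)"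
  have dh: "pderiv_along w ?h z = pderiv_along (fst w) h1 (fst z) + pderiv_along (snd w) h2 (snd z)"
    if "z \<in> U \<times> V" for z w
  proof -
    have "h1 differentiable (at (fst z))" "h2 differentiable (at (snd z))"
      using that smooth_onD[OF h1] smooth_onD[OF h2] by auto
    then show ?thesis by (simp add: pderiv_along_add pderiv_along_fst pderiv_along_snd)
  qed
  have "pderiv_along v (pderiv_along w ?h) (x, y)
    = pderiv_along v (\<lambda>z. pderiv_along (fst w) h1 (fst z) + pderiv_along (snd w) h2 (snd z)) (x, y)"
    by (rule pderiv_along_cong[OF open_UV xy dh])
  also have "\<dots> = pderiv_along (fst v) (pderiv_along (fst w) h1) x
      + pderiv_along (snd v) (pderiv_along (snd w) h2) y"
    using smooth_onD[OF smooth_on_pderiv_along[OF h1] x] smooth_onD[OF smooth_on_pderiv_along[OF h2] y]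
    by (simp add: pderiv_along_add pderiv_along_fst pderiv_along_snd)
  finally have 2: "pderiv_along v (pderiv_along w ?h) (x, y)
    = pderiv_along (fst v) (pderiv_along (fst w) h1) x + pderiv_along (snd v) (pderiv_along (snd w) h2) y" .
  note l1 = linear_pderiv_along[OF smooth_onD[OF h1 x]] and l2 = linear_pderiv_along[OF smooth_onD[OF h2 y]]
  show ?thesis
    unfolding hessian_def 2 dh[OF xy] christoffel_warped
    by (simp add: linear_diff[OF l1] linear_cmul[OF l1] linear_add[OF l2] linear_cmul[OF l2])
qed

end

lemma differentiable_\<phi>: "x \<in> U \<Longrightarrow> \<phi> differentiable (at x)"
  by (rule smooth_onD[OF smooth_\<phi>])

text \<open>The quotient is the coefficient in the mixed part of the connection, so the curvature
  contains its derivative.\<close>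

lemma log_derivative:
  assumes "x \<in> U"
  shows "(\<lambda>x. pderiv_along v \<phi> x / \<phi> x) differentiable (at x)"
    and "pderiv_along d (\<lambda>x. pderiv_along v \<phi> x / \<phi> x) x = pderiv_along d (pderiv_along v \<phi>) x / \<phi> x
      - pderiv_along v \<phi> x * pderiv_along d \<phi> x / (\<phi> x)\<^sup>2"
proof -
  have nz: "\<phi> x \<noteq> 0" using positive[OF assms] by simp
  have 1: "pderiv_along v \<phi> differentiable (at x)"
    by (rule smooth_onD[OF smooth_on_pderiv_along[OF smooth_\<phi>] assms])
  have 2: "(\<lambda>x. inverse (\<phi> x)) differentiable (at x)"
    using differentiable_\<phi>[OF assms] nz by simp
  show "(\<lambda>x. pderiv_along v \<phi> x / \<phi> x) differentiable (at x)"
    unfolding divide_inverse by (rule differentiable_mult[OF 1 2])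
  show "pderiv_along d (\<lambda>x. pderiv_along v \<phi> x / \<phi> x) x = pderiv_along d (pderiv_along v \<phi>) x / \<phi> x
    - pderiv_along v \<phi> x * pderiv_along d \<phi> x / (\<phi> x)\<^sup>2"
    using pderiv_along_mult[OF 1 2, of d]
    by (simp add: pderiv_along_inverse[OF differentiable_\<phi>[OF assms] nz] divide_inverse power2_eq_square)
qed

lemma differentiable_gradient_\<phi>: "x \<in> U \<Longrightarrow> gradient A \<phi> differentiable (at x)"
  by (rule smooth_onD[OF A.smooth_gradient[OF smooth_\<phi>]])

lemma vanishing_arguments:
  "x \<in> U \<Longrightarrow> christoffel A x v 0 = 0" "x \<in> U \<Longrightarrow> christoffel A x 0 v = 0"
  "y \<in> V \<Longrightarrow> christoffel C y w 0 = 0" "y \<in> V \<Longrightarrow> christoffel C y 0 w = 0"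
  "y \<in> V \<Longrightarrow> C y w 0 = 0" "y \<in> V \<Longrightarrow> C y 0 w = 0" "x \<in> U \<Longrightarrow> pderiv_along 0 \<phi> x = 0"
  using linear_0[OF A.linear_christoffel] linear_0[OF C.linear_christoffel]
    A.christoffel_commute C.christoffel_commute bilinear_lzero[OF C.bilinear] bilinear_rzero[OF C.bilinear]
    linear_0[OF linear_pderiv_along[OF differentiable_\<phi>]]
  by metis+

section \<open>Derivatives of the connection on vectors tangent to one factor\<close>

lemma pderiv_along_christoffel_warped:
  assumes xy: "x \<in> U" "y \<in> V"
    and PQ: "\<And>z. z \<in> U \<times> V \<Longrightarrow> christoffel W z v w = (P z, Q z)"
    and P: "P differentiable (at (x, y))" "pderiv_along d P (x, y) = P'"
    and Q: "Q differentiable (at (x, y))" "pderiv_along d Q (x, y) = Q'"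
  shows "pderiv_along d (\<lambda>z. christoffel W z v w) (x, y) = (P', Q')"
proof -
  have "pderiv_along d (\<lambda>z. christoffel W z v w) (x, y) = pderiv_along d (\<lambda>z. (P z, Q z)) (x, y)"
    using xy by (intro pderiv_along_cong[OF open_UV]) (auto simp: PQ)
  then show ?thesis by (simp add: pderiv_along_Pair P Q)
qed

text \<open>The copies of the base are totally geodesic: the connection on base vectors is that of
  the base.\<close>

lemma pderiv_along_christoffel_base_base:
  assumes "x \<in> U" "y \<in> V"
  shows "pderiv_along d (\<lambda>z. christoffel W z (v, 0) (w, 0)) (x, y)
    = (pderiv_along (fst d) (\<lambda>x. christoffel A x v w) x, 0)"
proof (rule pderiv_along_christoffel_warped[OF assms])
  note c = smooth_onD[OF A.smooth_christoffel assms(1)]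
  show "christoffel W z (v, 0) (w, 0) = (christoffel A (fst z) v w, 0)" if "z \<in> U \<times> V" for z
    using that by (cases z) (simp add: christoffel_warped vanishing_arguments)
  show "(\<lambda>z. christoffel A (fst z) v w) differentiable (at (x, y))"
    and "pderiv_along d (\<lambda>z. christoffel A (fst z) v w) (x, y) = pderiv_along (fst d) (\<lambda>x. christoffel A x v w) x"
    using pderiv_along_fst[where u = "\<lambda>x. christoffel A x v w" and z = "(x, y)"] c by simp_all
qed simp_all

lemma pderiv_along_christoffel_base_fiber:
  assumes "x \<in> U" "y \<in> V"
  shows "pderiv_along d (\<lambda>z. christoffel W z (v, 0) (0, w)) (x, y)
    = (0, pderiv_along (fst d) (\<lambda>x. pderiv_along v \<phi> x / \<phi> x) x *\<^sub>R w)"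
proof (rule pderiv_along_christoffel_warped[OF assms])
  note c = log_derivative(1)[OF assms(1), of v]
  have c': "(\<lambda>z. pderiv_along v \<phi> (fst z) / \<phi> (fst z)) differentiable (at (x, y))"
    "pderiv_along d (\<lambda>z. pderiv_along v \<phi> (fst z) / \<phi> (fst z)) (x, y)
      = pderiv_along (fst d) (\<lambda>x. pderiv_along v \<phi> x / \<phi> x) x"
    using pderiv_along_fst[where u = "\<lambda>x. pderiv_along v \<phi> x / \<phi> x" and z = "(x, y)"] c by simp_all
  show "christoffel W z (v, 0) (0, w) = (0, (pderiv_along v \<phi> (fst z) / \<phi> (fst z)) *\<^sub>R w)"
    if "z \<in> U \<times> V" for z
    using that by (cases z) (simp add: christoffel_warped vanishing_arguments)
  show "(\<lambda>z. (pderiv_along v \<phi> (fst z) / \<phi> (fst z)) *\<^sub>R w) differentiable (at (x, y))"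
    using differentiable_scaleR[OF c'(1) differentiable_const] .
  show "pderiv_along d (\<lambda>z. (pderiv_along v \<phi> (fst z) / \<phi> (fst z)) *\<^sub>R w) (x, y)
    = pderiv_along (fst d) (\<lambda>x. pderiv_along v \<phi> x / \<phi> x) x *\<^sub>R w"
    using pderiv_along_scaleR[OF c'(1) differentiable_const, of d w] c'(2) by simp
qed simp_all

lemma pderiv_along_christoffel_fiber_base:
  assumes "x \<in> U" "y \<in> V"
  shows "pderiv_along d (\<lambda>z. christoffel W z (0, w) (v, 0)) (x, y)
    = (0, pderiv_along (fst d) (\<lambda>x. pderiv_along v \<phi> x / \<phi> x) x *\<^sub>R w)"
proof -
  have "pderiv_along d (\<lambda>z. christoffel W z (0, w) (v, 0)) (x, y)
    = pderiv_along d (\<lambda>z. christoffel W z (v, 0) (0, w)) (x, y)"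
    using assms by (intro pderiv_along_cong[OF open_UV] W.christoffel_commute) auto
  then show ?thesis using pderiv_along_christoffel_base_fiber[OF assms] by simp
qed

lemma pderiv_along_christoffel_fiber_fiber:
  assumes "x \<in> U" "y \<in> V"
  shows "pderiv_along d (\<lambda>z. christoffel W z (0, v) (0, w)) (x, y)
    = (- (C y v w * \<phi> x) *\<^sub>R pderiv_along (fst d) (gradient A \<phi>) x
       - (C y v w * pderiv_along (fst d) \<phi> x + pderiv_along (snd d) (\<lambda>y. C y v w) y * \<phi> x) *\<^sub>R gradient A \<phi> x,
       pderiv_along (snd d) (\<lambda>y. christoffel C y v w) y)"
proof (rule pderiv_along_christoffel_warped[OF assms])
  have c: "(\<lambda>z. C (snd z) v w) differentiable (at (x, y))"
    "pderiv_along d (\<lambda>z. C (snd z) v w) (x, y) = pderiv_along (snd d) (\<lambda>y. C y v w) y"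
    using pderiv_along_snd[where u = "\<lambda>y. C y v w" and z = "(x, y)"] C.differentiable[OF assms(2)] by simp_all
  have p: "(\<lambda>z. \<phi> (fst z)) differentiable (at (x, y))"
    "pderiv_along d (\<lambda>z. \<phi> (fst z)) (x, y) = pderiv_along (fst d) \<phi> x"
    using pderiv_along_fst[where u = \<phi> and z = "(x, y)"] differentiable_\<phi>[OF assms(1)] by simp_all
  have g: "(\<lambda>z. gradient A \<phi> (fst z)) differentiable (at (x, y))"
    "pderiv_along d (\<lambda>z. gradient A \<phi> (fst z)) (x, y) = pderiv_along (fst d) (gradient A \<phi>) x"
    using pderiv_along_fst[where u = "gradient A \<phi>" and z = "(x, y)"] differentiable_gradient_\<phi>[OF assms(1)] by simp_all
  note cp = differentiable_mult[OF c(1) p(1)]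
  note cpg = differentiable_scaleR[OF cp g(1)]
  show "christoffel W z (0, v) (0, w)
      = (0 - (C (snd z) v w * \<phi> (fst z)) *\<^sub>R gradient A \<phi> (fst z), christoffel C (snd z) v w)"
    if "z \<in> U \<times> V" for z
    using that by (cases z) (simp add: christoffel_warped vanishing_arguments)
  show "(\<lambda>z. 0 - (C (snd z) v w * \<phi> (fst z)) *\<^sub>R gradient A \<phi> (fst z)) differentiable (at (x, y))"
    by (rule differentiable_diff[OF differentiable_const cpg])
  show "pderiv_along d (\<lambda>z. 0 - (C (snd z) v w * \<phi> (fst z)) *\<^sub>R gradient A \<phi> (fst z)) (x, y)
    = - (C y v w * \<phi> x) *\<^sub>R pderiv_along (fst d) (gradient A \<phi>) x
       - (C y v w * pderiv_along (fst d) \<phi> x + pderiv_along (snd d) (\<lambda>y. C y v w) y * \<phi> x) *\<^sub>R gradient A \<phi> x"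
    unfolding pderiv_along_diff[OF differentiable_const cpg] pderiv_along_scaleR[OF cp g(1)]
      pderiv_along_mult[OF c(1) p(1)] c(2) p(2) g(2)
    by simp
  show "(\<lambda>z. christoffel C (snd z) v w) differentiable (at (x, y))"
    "pderiv_along d (\<lambda>z. christoffel C (snd z) v w) (x, y) = pderiv_along (snd d) (\<lambda>y. christoffel C y v w) y"
    using pderiv_along_snd[where u = "\<lambda>y. christoffel C y v w" and z = "(x, y)"]
      smooth_onD[OF C.smooth_christoffel assms(2)] by simp_all
qed

section \<open>Riemann, Ricci and scalar curvature of the warped product\<close>

lemma riemann_warped_base:
  assumes "x \<in> U" "y \<in> V"
  shows "riemann W (x, y) (b, 0) (v, 0) (w, 0) = (riemann A x b v w, 0)"
  unfolding riemann_def pderiv_along_christoffel_base_base[OF assms]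
  by (simp add: christoffel_warped[OF assms] vanishing_arguments assms)

text \<open>The product of first derivatives of \<phi> from the quotient rule cancels against the
  iterated mixed connection term. A second derivative of \<phi> and its connection correction
  remain, which is the Hessian.\<close>

lemma riemann_warped_fiber_base:
  assumes "x \<in> U" "y \<in> V"
  shows "riemann W (x, y) (0, b) (v, 0) (w, 0) = (0, - (hessian A \<phi> x v w / \<phi> x) *\<^sub>R b)"
proof -
  have z: "pderiv_along 0 (\<lambda>x. christoffel A x v w) x = 0" for v w
    by (rule pderiv_along_zero[OF smooth_onD[OF A.smooth_christoffel assms(1)]])
  have "\<phi> x > 0" using positive[OF assms(1)] .
  then show ?thesis
    unfolding riemann_def pderiv_along_christoffel_base_base[OF assms]
      pderiv_along_christoffel_fiber_base[OF assms] hessian_def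
    by (simp add: christoffel_warped[OF assms] vanishing_arguments assms log_derivative(2) z
        scaleR_diff_left[symmetric] scaleR_add_left[symmetric] scaleR_minus_left[symmetric] del: scaleR_minus_left)
      (simp add: field_simps power2_eq_square)
qed

text \<open>The terms with \<open>D_b \<phi>\<close> times the gradient cancel between the
  differentiated and the iterated connection. What is left is a multiple of the Hessian
  endomorphism, whose trace over \<open>b\<close> is the Laplacian.\<close>

lemma riemann_warped_base_fiber:
  assumes "x \<in> U" "y \<in> V"
  shows "riemann W (x, y) (b, 0) (0, v) (0, w)
    = (- (C y v w * \<phi> x) *\<^sub>R (pderiv_along b (gradient A \<phi>) x + christoffel A x b (gradient A \<phi> x)), 0)"
proof -
  have z: "pderiv_along 0 (\<lambda>y. christoffel C y v w) y = 0" for v w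
    by (rule pderiv_along_zero[OF smooth_onD[OF C.smooth_christoffel assms(2)]])
  have z2: "pderiv_along 0 (\<lambda>y. C y v w) y = 0" 
    by (rule pderiv_along_zero[OF C.differentiable[OF assms(2)]])
  have z3: "pderiv_along 0 (\<lambda>x. pderiv_along b \<phi> x / \<phi> x) x = 0"
    by (rule pderiv_along_zero[OF log_derivative(1)[OF assms(1)]])
  note l = A.linear_christoffel[OF assms(1)] and cb = C.bilinear[OF assms(2)]
  have "\<phi> x > 0" using positive[OF assms(1)] .
  then show ?thesis
    unfolding riemann_def pderiv_along_christoffel_fiber_fiber[OF assms]
      pderiv_along_christoffel_base_fiber[OF assms]
    by (simp add: christoffel_warped[OF assms] vanishing_arguments assms z z2 z3
        linear_neg[OF l] linear_diff[OF l] linear_cmul[OF l] linear_cmul[OF C.linear_christoffel[OF assms(2)]] bilinear_rmul[OF cb] algebra_simps)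
qed

text \<open>The fibers are umbilic, with second fundamental form
  \<open>-C(v,w) \<phi> grad \<phi>\<close>; the last term is its contribution in the Gauss
  equation. The fiber component is what the trace over fiber directions takes.\<close>

lemma riemann_warped_fiber:
  assumes "x \<in> U" "y \<in> V"
  shows "snd (riemann W (x, y) (0, b) (0, v) (0, w))
    = riemann C y b v w - pderiv_along (gradient A \<phi> x) \<phi> x *\<^sub>R (C y v w *\<^sub>R b - C y b w *\<^sub>R v)"
proof -
  note l = linear_pderiv_along[OF differentiable_\<phi>[OF assms(1)]]
    and lC = C.linear_christoffel[OF assms(2)]
  have "\<phi> x > 0" using positive[OF assms(1)] .
  then show ?thesis
    unfolding riemann_def pderiv_along_christoffel_fiber_fiber[OF assms]
    by (simp add: christoffel_warped[OF assms] vanishing_arguments assms 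
        linear_neg[OF l] linear_cmul[OF l] linear_cmul[OF lC] algebra_simps)
qed

lemma ricci_warped_base:
  assumes "x \<in> U" "y \<in> V"
  shows "ricci W (x, y) (v, 0) (w, 0) = ricci A x v w - DIM('f) * hessian A \<phi> x v w / \<phi> x"
  by (simp add: ricci_def sum_Basis_prod riemann_warped_base[OF assms]
      riemann_warped_fiber_base[OF assms] inner_Pair)

text \<open>The base directions give the Laplacian term. In the fiber directions
  \<open>b \<mapsto> C(v,w) b - C(b,w) v\<close> has trace \<open>(n - 1) C(v,w)\<close>, where
  \<open>n\<close> is the dimension of the fiber.\<close>

lemma ricci_warped_fiber:
  assumes "x \<in> U" "y \<in> V"
  shows "ricci W (x, y) (0, v) (0, w) = ricci C y v w
    - (\<phi> x * laplacian A \<phi> x + (DIM('f) - 1) * pderiv_along (gradient A \<phi> x) \<phi> x) * C y v w"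
proof -
  have "(\<Sum>b\<in>Basis. C y b w * (v \<bullet> b)) = C y v w"
    using C.expand_left[OF assms(2), of v w] by (simp add: mult.commute)
  then have "(\<Sum>b\<in>Basis. snd (riemann W (x, y) (0, b) (0, v) (0, w)) \<bullet> b)
    = ricci C y v w - pderiv_along (gradient A \<phi> x) \<phi> x * (DIM('f) * C y v w - C y v w)"
    by (simp add: riemann_warped_fiber[OF assms] ricci_def inner_diff_left sum_subtractf
        sum_distrib_left[symmetric])
  moreover have "(\<Sum>b\<in>Basis. fst (riemann W (x, y) (b, 0) (0, v) (0, w)) \<bullet> b)
    = - (C y v w * \<phi> x * laplacian A \<phi> x)"
    by (simp add: riemann_warped_base_fiber[OF assms] A.laplacian_eq_divergence[OF assms(1) smooth_\<phi>]
        sum_negf sum_distrib_left)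
  ultimately show ?thesis
    by (simp add: ricci_def sum_Basis_prod inner_prod_def of_nat_diff algebra_simps)
qed

text \<open>The metric is block diagonal, so indices are raised in each factor separately; the fiber
  block \<open>\<phi>^2 C\<close> brings in the factor \<open>1 / \<phi>^2\<close>.\<close>

lemma sharp_warped:
  assumes "x \<in> U" "y \<in> V" "linear \<alpha>"
  shows "sharp (W (x, y)) \<alpha>
    = (sharp (A x) (\<lambda>u. \<alpha> (u, 0)), (1 / (\<phi> x)\<^sup>2) *\<^sub>R sharp (C y) (\<lambda>u. \<alpha> (0, u)))"
proof (rule sharp_eqI[OF nondegenerate_warped_form[OF assms(1,2)]])
  fix u
  have Pair1: "linear (\<lambda>u::'e. (u, 0::'f))" and Pair2: "linear (\<lambda>u::'f. (0::'e, u))"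
    by (auto intro!: linearI)
  have l: "linear (\<lambda>u. \<alpha> (u, 0))" "linear (\<lambda>u. \<alpha> (0, u))"
    using linear_compose[OF Pair1 assms(3)] linear_compose[OF Pair2 assms(3)]
    by (simp_all add: o_def)
  have "\<alpha> u = \<alpha> (fst u, 0) + \<alpha> (0, snd u)"
    by (simp add: linear_add[OF assms(3), symmetric])
  then show "W (x, y) (sharp (A x) (\<lambda>u. \<alpha> (u, 0)), (1 / (\<phi> x)\<^sup>2) *\<^sub>R sharp (C y) (\<lambda>u. \<alpha> (0, u))) u = \<alpha> u"
    using positive[OF assms(1)]
    by (simp add: warped_form_def bilinear_lmul[OF C.bilinear[OF assms(2)]]
        form_sharp[OF A.nondegenerate[OF assms(1)] l(1)] form_sharp[OF C.nondegenerate[OF assms(2)] l(2)])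
qed

text \<open>The Laplacian appears \<open>2n\<close> times: \<open>n\<close> times from the base
  block, where every fiber direction subtracts the Hessian over \<phi>, and \<open>n\<close> times
  from the fiber block, where a multiple of the metric is traced.\<close>

theorem scalar_curvature_warped:
  assumes "x \<in> U" "y \<in> V"
  shows "scalar_curvature W (x, y) = scalar_curvature A x + scalar_curvature C y / (\<phi> x)\<^sup>2
    - 2 * DIM('f) * laplacian A \<phi> x / \<phi> x
    - DIM('f) * (DIM('f) - 1) * pderiv_along (gradient A \<phi> x) \<phi> x / (\<phi> x)\<^sup>2"
proof -
  note nA = A.nondegenerate[OF assms(1)] and nC = C.nondegenerate[OF assms(2)]
  note a = A.bilinear[OF assms(1)] and c = C.bilinear[OF assms(2)]
  let ?Z = "\<lambda>v. pderiv_along v (gradient A \<phi>) x + christoffel A x v (gradient A \<phi> x)"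
  let ?k = "\<phi> x * laplacian A \<phi> x + (DIM('f) - 1) * pderiv_along (gradient A \<phi> x) \<phi> x"
  \<comment> \<open>For \<open>b\<close> tangent to one factor only the component of this vector in
    that factor is summed, so the two diagonal blocks of the Ricci tensor suffice.\<close>
  have s: "sharp (W (x, y)) (ricci W (x, y) b)
    = (sharp (A x) (\<lambda>u. ricci W (x, y) b (u, 0)), (1 / (\<phi> x)\<^sup>2) *\<^sub>R sharp (C y) (\<lambda>u. ricci W (x, y) b (0, u)))" for b
    using assms by (intro sharp_warped W.linear_ricci) auto
  have base: "sharp (A x) (\<lambda>u. ricci W (x, y) (b, 0) (u, 0))
    = sharp (A x) (ricci A x b) - (DIM('f) / \<phi> x) *\<^sub>R ?Z b" for b
    by (rule sharp_eqI[OF nA])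
      (simp add: ricci_warped_base[OF assms] A.hessian_eq_gradient[OF assms(1) smooth_\<phi>]
        bilinear_lsub[OF a] bilinear_lmul[OF a] form_sharp[OF nA A.linear_ricci[OF assms(1)]])
  have fiber: "sharp (C y) (\<lambda>u. ricci W (x, y) (0, b) (0, u)) = sharp (C y) (ricci C y b) - ?k *\<^sub>R b" for b
    by (rule sharp_eqI[OF nC])
      (simp add: ricci_warped_fiber[OF assms] bilinear_lsub[OF c] bilinear_lmul[OF c]
        form_sharp[OF nC C.linear_ricci[OF assms(2)]])
  have 1: "(\<Sum>b\<in>Basis. (sharp (A x) (ricci A x b) - (DIM('f) / \<phi> x) *\<^sub>R ?Z b) \<bullet> b)
    = scalar_curvature A x - DIM('f) * laplacian A \<phi> x / \<phi> x"
    unfolding inner_diff_left sum_subtractf inner_scaleR_left sum_distrib_left[symmetric]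
    by (simp add: scalar_curvature_def A.laplacian_eq_divergence[OF assms(1) smooth_\<phi>])
  have 2: "(\<Sum>b\<in>Basis. (sharp (C y) (ricci C y b) - ?k *\<^sub>R b) \<bullet> b) = scalar_curvature C y - DIM('f) * ?k"
    by (simp add: inner_diff_left sum_subtractf scalar_curvature_def)
  have "scalar_curvature W (x, y)
    = (\<Sum>b\<in>Basis. (sharp (A x) (ricci A x b) - (DIM('f) / \<phi> x) *\<^sub>R ?Z b) \<bullet> b)
      + (1 / (\<phi> x)\<^sup>2) * (\<Sum>b\<in>Basis. (sharp (C y) (ricci C y b) - ?k *\<^sub>R b) \<bullet> b)"
    unfolding scalar_curvature_def[of W] sum_Basis_prod s base fiber sum_distrib_left
    by (simp add: inner_prod_def)
  moreover have "(1 / (\<phi> x)\<^sup>2) * (scalar_curvature C y - DIM('f) * ?k) = scalar_curvature C y / (\<phi> x)\<^sup>2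
      - DIM('f) * laplacian A \<phi> x / \<phi> x
      - DIM('f) * (DIM('f) - 1) * pderiv_along (gradient A \<phi> x) \<phi> x / (\<phi> x)\<^sup>2"
    using positive[OF assms(1)] by (simp add: field_simps power2_eq_square)
  ultimately show ?thesis
    unfolding 1 2 by simp
qed

end

section \<open>Charts\<close>

lemma chart_inv_chart:
  assumes "smooth_manifold M" "c \<in> atlas M"
  shows "p \<in> fst c \<Longrightarrow> chart_inv c (snd c p) = p"
    and "x \<in> chart_image c \<Longrightarrow> snd c (chart_inv c x) = x"
    and "x \<in> chart_image c \<Longrightarrow> chart_inv c x \<in> fst c"
    and "open (chart_image c)" and "fst c \<subseteq> points M" and "inj_on (snd c) (fst c)"
proof -
  have h: "homeomorphic_map (subtopology (top_of M) (fst c)) (top_of_set (chart_image c)) (snd c)"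
    and o: "openin (top_of M) (fst c)"
    using assms by (auto simp: smooth_manifold_def)
  show s: "fst c \<subseteq> points M" using o by (rule openin_subset)
  show i: "inj_on (snd c) (fst c)"
    using h s by (simp add: homeomorphic_map_def bijective_closed_imp_homeomorphic_map Int_absorb1 topspace_subtopology homeomorphic_eq_everything_map)
  show "p \<in> fst c \<Longrightarrow> chart_inv c (snd c p) = p"
    using i by (simp add: chart_inv_def)
  show "x \<in> chart_image c \<Longrightarrow> snd c (chart_inv c x) = x"
    "x \<in> chart_image c \<Longrightarrow> chart_inv c x \<in> fst c"
    by (auto simp: chart_inv_def chart_image_def f_inv_into_f inv_into_into)
  show "open (chart_image c)" using assms by (auto simp: smooth_manifold_def)
qed

lemma obtain_chart:
  assumes "smooth_manifold M" "p \<in> points M"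
  obtains c x where "c \<in> atlas M" "x \<in> chart_image c" "chart_inv c x = p" "p \<in> fst c"
proof -
  obtain c where c: "c \<in> atlas M" "p \<in> fst c"
    using assms unfolding smooth_manifold_def by blast
  show thesis
    by (rule that[OF c(1) _ _ c(2), of "snd c p"])
      (use c chart_inv_chart(1)[OF assms(1) c] in \<open>auto simp: chart_image_def\<close>)
qed

lemma smooth_funD:
  "smooth_fun M u \<Longrightarrow> c \<in> atlas M \<Longrightarrow> smooth_on (u \<circ> chart_inv c) (chart_image c)"
  by (simp add: smooth_fun_def)

lemma openin_chart_preimage:
  assumes "smooth_manifold M" "c \<in> atlas M" "open S" "S \<subseteq> chart_image c"
  shows "openin (top_of M) (chart_inv c ` S)"
proof -
  have h: "homeomorphic_map (subtopology (top_of M) (fst c)) (top_of_set (chart_image c)) (snd c)"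
    and o: "openin (top_of M) (fst c)"
    using assms by (auto simp: smooth_manifold_def)
  have "openin (subtopology (top_of M) (fst c)) {p \<in> topspace (subtopology (top_of M) (fst c)). snd c p \<in> S}"
    using assms(3,4) by (intro openin_continuous_map_preimage[OF homeomorphic_imp_continuous_map[OF h]])
      (auto simp: openin_open)
  moreover have "{p \<in> topspace (subtopology (top_of M) (fst c)). snd c p \<in> S} = chart_inv c ` S"
    using chart_inv_chart[OF assms(1,2)] assms(4) by (force simp: topspace_subtopology)
  ultimately show ?thesis using o openin_trans_full by metis
qed

text \<open>A vanishing derivative makes \<open>u\<close> constant on balls in charts, hence locally
  constant. A level set and its complement are then both open, and connectedness excludes a second
  value.\<close>

lemma constant_fun_of_pderiv_along:
  assumes M: "smooth_manifold M" "connected_space (top_of M)" and u: "smooth_fun M u"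
    and zero: "\<And>c x v. c \<in> atlas M \<Longrightarrow> x \<in> chart_image c \<Longrightarrow> pderiv_along v (u \<circ> chart_inv c) x = 0"
  shows "constant_fun M u"
proof -
  have near: "\<exists>N. openin (top_of M) N \<and> p \<in> N \<and> (\<forall>q\<in>N. u q = u p)" if p: "p \<in> points M" for p
  proof -
    obtain c x where c: "c \<in> atlas M" "x \<in> chart_image c" "chart_inv c x = p"
      using obtain_chart[OF M(1) p] by metis
    obtain r where r: "r > 0" "ball x r \<subseteq> chart_image c"
      using chart_inv_chart(4)[OF M(1) c(1)] c(2) open_contains_ball by blast
    have "\<exists>a. \<forall>y\<in>ball x r. (u \<circ> chart_inv c) y = a"
    proof (rule has_derivative_zero_constant)
      fix y assume "y \<in> ball x r"
      then have y: "y \<in> chart_image c" using r by blast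
      have "((u \<circ> chart_inv c) has_derivative (\<lambda>v. 0)) (at y)"
        using has_derivative_pderiv_along[OF smooth_onD[OF smooth_funD[OF u c(1)] y]] zero[OF c(1) y]
        by simp
      then show "((u \<circ> chart_inv c) has_derivative (\<lambda>v. 0)) (at y within ball x r)"
        by (rule has_derivative_at_withinI)
    qed simp
    then have *: "u (chart_inv c y) = u p" if "y \<in> ball x r" for y
      using that r(1) c(3) by (metis centre_in_ball comp_apply)
    show ?thesis
    proof (intro exI conjI)
      show "openin (top_of M) (chart_inv c ` ball x r)"
        by (rule openin_chart_preimage[OF M(1) c(1) open_ball r(2)])
      show "p \<in> chart_inv c ` ball x r" using r(1) c(3) by force
      show "\<forall>q\<in>chart_inv c ` ball x r. u q = u p" using * by auto
    qed
  qed
  have op: "openin (top_of M) {q \<in> points M. P (u q)}" for P :: "real \<Rightarrow> bool"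
  proof (subst openin_subopen, intro ballI)
    fix p assume p: "p \<in> {q \<in> points M. P (u q)}"
    then obtain N where N: "openin (top_of M) N" "p \<in> N" "\<forall>q\<in>N. u q = u p" using near by blast
    have "N \<subseteq> {q \<in> points M. P (u q)}"
    proof
      fix q assume q: "q \<in> N"
      show "q \<in> {q \<in> points M. P (u q)}"
        using p openin_subset[OF N(1)] q bspec[OF N(3) q] by auto
    qed
    with N(1,2) show "\<exists>N. openin (top_of M) N \<and> p \<in> N \<and> N \<subseteq> {q \<in> points M. P (u q)}" by blast
  qed
  obtain p where p: "p \<in> points M" using M(1) unfolding smooth_manifold_def by blast
  have "u q = u p" if q: "q \<in> points M" for q
  proof (rule ccontr)
    assume "u q \<noteq> u p"
    define E E' where "E = {q \<in> points M. u q = u p}" and "E' = {q \<in> points M. u q \<noteq> u p}"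
    have "openin (top_of M) E \<and> openin (top_of M) E' \<and> points M \<subseteq> E \<union> E' \<and> E \<inter> E' = {} \<and> E \<noteq> {} \<and> E' \<noteq> {}"
      using op[of "\<lambda>t. t = u p"] op[of "\<lambda>t. t \<noteq> u p"] p q \<open>u q \<noteq> u p\<close>
      unfolding E_def E'_def by blast
    then show False using M(2) unfolding connected_space_def by blast
  qed
  then show ?thesis by (auto simp: constant_fun_def)
qed

lemma coordinate_metric_components:
  assumes "pseudo_Riemannian M g" "c \<in> atlas M"
  shows "coordinate_metric (components M g c) (chart_image c)"
proof
  show "open (chart_image c)"
    using assms by (auto simp: pseudo_Riemannian_def intro: chart_inv_chart(4))
qed (use assms in \<open>auto simp: pseudo_Riemannian_def nondegenerate_form_def\<close>)

section \<open>Changes of charts\<close>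

context
  fixes M :: "('p, 'e::euclidean_space) manifold" and c d
  assumes M: "smooth_manifold M" and c: "c \<in> atlas M" and d: "d \<in> atlas M"
begin

private abbreviation "S \<equiv> snd c ` (fst c \<inter> fst d)"
private abbreviation "T \<equiv> snd d \<circ> chart_inv c"

lemma overlap:
  shows "open S" and "S \<subseteq> chart_image c" and "T ` S \<subseteq> snd d ` (fst d \<inter> fst c)"
    and "smooth_on T S" and "x \<in> S \<Longrightarrow> chart_inv d (T x) = chart_inv c x"
proof -
  have h: "homeomorphic_map (subtopology (top_of M) (fst c)) (top_of_set (chart_image c)) (snd c)"
    and o: "openin (top_of M) (fst c)" "openin (top_of M) (fst d)"
    using M c d by (auto simp: smooth_manifold_def)
  have "openin (subtopology (top_of M) (fst c)) (fst c \<inter> fst d)"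
    using o by (simp add: openin_subtopology_Int2)
  then have "openin (top_of_set (chart_image c)) S"
    using homeomorphic_imp_open_map[OF h] by (simp add: open_map_def)
  then show "open S" using chart_inv_chart(4)[OF M c] openin_open_trans by blast
  show "S \<subseteq> chart_image c" by (auto simp: chart_image_def)
  show "T ` S \<subseteq> snd d ` (fst d \<inter> fst c)" using chart_inv_chart(1)[OF M c] by auto
  show "smooth_on T S" using M c d by (auto simp: smooth_manifold_def)
  show "x \<in> S \<Longrightarrow> chart_inv d (T x) = chart_inv c x"
    using chart_inv_chart(1)[OF M c] chart_inv_chart(1)[OF M d] by auto
qed

text \<open>As tangent vectors are functionals, this is the chain rule for each smooth test
  function; on the other functions both sides have the default value 0.\<close>

lemma coord_vec_transition:
  assumes "x \<in> S"
  shows "coord_vec M c x v = coord_vec M d (T x) (pderiv_along v T x)"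
proof
  fix u
  show "coord_vec M c x v u = coord_vec M d (T x) (pderiv_along v T x) u"
  proof (cases "smooth_fun M u")
    case True
    have "T x \<in> chart_image d" using overlap(3) assms by (auto simp: chart_image_def)
    then have ud: "(u \<circ> chart_inv d) differentiable (at (T x))"
      by (rule smooth_onD[OF smooth_funD[OF True d]])
    have "pderiv_along v (u \<circ> chart_inv c) x = pderiv_along v (\<lambda>y. (u \<circ> chart_inv d) (T y)) x"
      by (rule pderiv_along_cong[OF overlap(1) assms]) (use overlap(5) in auto)
    also have "\<dots> = pderiv_along (pderiv_along v T x) (u \<circ> chart_inv d) (T x)"
      by (rule pderiv_along_compose[OF has_derivative_pderiv_along[OF smooth_onD[OF overlap(4) assms]] ud])
    finally show ?thesis using True by (simp add: coord_vec_def pderiv_along_def)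
  qed (simp add: coord_vec_def)
qed

end

text \<open>The chain rule for \<open>?T o ?R = id\<close> shows that the derivative of the opposite
  transition map \<open>?R\<close> is a right inverse.\<close>

lemma surj_transition:
  assumes M: "smooth_manifold M" and c: "c \<in> atlas M" and d: "d \<in> atlas M"
    and x: "x \<in> snd c ` (fst c \<inter> fst d)"
  shows "surj (\<lambda>v. pderiv_along v (snd d \<circ> chart_inv c) x)"
proof -
  let ?T = "snd d \<circ> chart_inv c" and ?R = "snd c \<circ> chart_inv d"
  let ?S' = "snd d ` (fst d \<inter> fst c)"
  have Tx: "?T x \<in> ?S'" using overlap(3)[OF M c d] x by blast
  have TR: "?T (?R y) = y" if "y \<in> ?S'" for y
    using that chart_inv_chart(1)[OF M c] chart_inv_chart(1)[OF M d] by auto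
  have RT: "?R (?T x) = x"
    using x chart_inv_chart(1)[OF M c] chart_inv_chart(1)[OF M d] by auto
  have "pderiv_along (pderiv_along v ?R (?T x)) ?T x = v" for v
  proof -
    have T: "?T differentiable (at (?R (?T x)))"
      unfolding RT by (rule smooth_onD[OF overlap(4)[OF M c d] x])
    have "v = pderiv_along v (\<lambda>y. y) (?T x)"
      by (simp add: pderiv_along_def)
    also have "\<dots> = pderiv_along v (\<lambda>y. ?T (?R y)) (?T x)"
      by (rule pderiv_along_cong[OF overlap(1)[OF M d c] Tx]) (use TR in auto)
    also have "\<dots> = pderiv_along (pderiv_along v ?R (?T x)) ?T (?R (?T x))"
      by (rule pderiv_along_compose[OF has_derivative_pderiv_along[OF smooth_onD[OF overlap(4)[OF M d c] Tx]] T])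
    finally show ?thesis unfolding RT by (rule sym)
  qed
  then show ?thesis by (rule surjI)
qed

text \<open>The components in both charts evaluate the same form on the same tangent functionals, so
  the pullback relation reduces to \<open>coord_vec_transition\<close>.\<close>

lemma coordinate_change_transition:
  assumes g: "pseudo_Riemannian M g" and c: "c \<in> atlas M" and d: "d \<in> atlas M"
  shows "coordinate_change (components M g c) (chart_image c) (components M g d) (chart_image d)
    (snd d \<circ> chart_inv c) (snd c ` (fst c \<inter> fst d))"
proof -
  have M: "smooth_manifold M" using g by (simp add: pseudo_Riemannian_def)
  interpret c: coordinate_metric "components M g c" "chart_image c"
    by (rule coordinate_metric_components[OF g c])
  interpret d: coordinate_metric "components M g d" "chart_image d"
    by (rule coordinate_metric_components[OF g d])
  note o = overlap[OF M c d]
  show ?thesis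
  proof
    show "(snd d \<circ> chart_inv c) ` snd c ` (fst c \<inter> fst d) \<subseteq> chart_image d"
      using o(3) by (auto simp: chart_image_def)
    show "surj (\<lambda>v. pderiv_along v (snd d \<circ> chart_inv c) x)" if "x \<in> snd c ` (fst c \<inter> fst d)" for x
      by (rule surj_transition[OF M c d that])
    show "components M g c x v w = components M g d ((snd d \<circ> chart_inv c) x)
        (pderiv_along v (snd d \<circ> chart_inv c) x) (pderiv_along w (snd d \<circ> chart_inv c) x)"
      if "x \<in> snd c ` (fst c \<inter> fst d)" for x v w
      unfolding components_def o(5)[OF that] coord_vec_transition[OF M c d that] ..
  qed (rule o)+
qed

text \<open>A chart is picked separately at each point; this yields a function on the manifold, as
  required for \<rho>, at the cost of having to prove independence of the choice.\<close>

definition manifold_laplacian ::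
  "('p, 'e::euclidean_space) manifold \<Rightarrow> 'p form2 \<Rightarrow> ('p \<Rightarrow> real) \<Rightarrow> 'p \<Rightarrow> real" where
  "manifold_laplacian M g u p = (let c = SOME c. c \<in> atlas M \<and> p \<in> fst c in
     laplacian (components M g c) (u \<circ> chart_inv c) (snd c p))"

text \<open>The derivative of \<open>u\<close> along its own gradient is
  \<open>g(grad u, grad u)\<close>, which may be negative for an indefinite metric.\<close>

definition gradient_square ::
  "('p, 'e::euclidean_space) manifold \<Rightarrow> 'p form2 \<Rightarrow> ('p \<Rightarrow> real) \<Rightarrow> 'p \<Rightarrow> real" where
  "gradient_square M g u p = (let c = SOME c. c \<in> atlas M \<and> p \<in> fst c in
     pderiv_along (gradient (components M g c) (u \<circ> chart_inv c) (snd c p)) (u \<circ> chart_inv c) (snd c p))"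

text \<open>The point lies in the overlap of \<open>c\<close> and the picked chart, where the
  transformation rules apply. With \<open>c\<close> fixed, the right-hand sides are visibly
  smooth.\<close>

lemma
  assumes g: "pseudo_Riemannian M g" and u: "smooth_fun M u"
    and c: "c \<in> atlas M" and x: "x \<in> chart_image c"
  shows manifold_laplacian_chart:
      "manifold_laplacian M g u (chart_inv c x) = laplacian (components M g c) (u \<circ> chart_inv c) x"
    and gradient_square_chart:
      "gradient_square M g u (chart_inv c x)
       = pderiv_along (gradient (components M g c) (u \<circ> chart_inv c) x) (u \<circ> chart_inv c) x"
proof -
  have M: "smooth_manifold M" using g by (simp add: pseudo_Riemannian_def)
  let ?p = "chart_inv c x"
  define d where "d = (SOME d. d \<in> atlas M \<and> ?p \<in> fst d)"
  have p: "?p \<in> fst c" "snd c ?p = x" using chart_inv_chart[OF M c] x by auto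
  have d: "d \<in> atlas M" "?p \<in> fst d"
    using someI[of "\<lambda>d. d \<in> atlas M \<and> ?p \<in> fst d" c] c p(1) by (auto simp: d_def)
  have xS: "x \<in> snd c ` (fst c \<inter> fst d)" using p d(2) by force
  have T: "(snd d \<circ> chart_inv c) x = snd d ?p" by simp
  note cc = coordinate_change_transition[OF g c d(1)]
  note uc = smooth_funD[OF u c] and ud = smooth_funD[OF u d(1)]
  have ucd: "(u \<circ> chart_inv c) x = (u \<circ> chart_inv d) ((snd d \<circ> chart_inv c) x)"
    if "x \<in> snd c ` (fst c \<inter> fst d)" for x
    using overlap(5)[OF M c d(1) that] by simp
  show "manifold_laplacian M g u ?p = laplacian (components M g c) (u \<circ> chart_inv c) x"
    using coordinate_change.laplacian_transform[OF cc uc ud ucd xS]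
    by (simp add: manifold_laplacian_def d_def[symmetric] Let_def o_def)
  show "gradient_square M g u ?p
       = pderiv_along (gradient (components M g c) (u \<circ> chart_inv c) x) (u \<circ> chart_inv c) x"
    using coordinate_change.gradient_norm_transform[OF cc uc ud ucd xS]
    by (simp add: gradient_square_def d_def[symmetric] Let_def o_def)
qed

section \<open>Products of charts\<close>

abbreviation prod_chart :: "('p, 'e) chart \<Rightarrow> ('q, 'f) chart \<Rightarrow> ('p \<times> 'q, 'e \<times> 'f) chart" where
  "prod_chart c d \<equiv> (fst c \<times> fst d, map_prod (snd c) (snd d))"

lemma chart_image_prod: "chart_image (prod_chart c d) = chart_image c \<times> chart_image d"
  by (auto simp: chart_image_def)

lemma ball_atlas_prod:
  "(\<forall>e\<in>atlas (prod_manifold B F). P e) \<longleftrightarrow> (\<forall>c\<in>atlas B. \<forall>d\<in>atlas F. P (prod_chart c d))"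
  (is "?L \<longleftrightarrow> ?R")
proof
  assume L: ?L
  show ?R
  proof (intro ballI)
    fix c d assume "c \<in> atlas B" "d \<in> atlas F"
    then have "prod_chart c d \<in> atlas (prod_manifold B F)"
      unfolding prod_manifold_def manifold.simps mem_Collect_eq by blast
    then show "P (prod_chart c d)" using L by blast
  qed
next
  assume R: ?R
  show ?L
  proof
    fix e assume "e \<in> atlas (prod_manifold B F)"
    then obtain c d where "c \<in> atlas B" "d \<in> atlas F" "e = prod_chart c d"
      by (auto simp: prod_manifold_def)
    then show "P e" using R by simp
  qed
qed

context
  fixes B :: "('p, 'e::euclidean_space) manifold" and F :: "('q, 'f::euclidean_space) manifold"
  assumes B: "smooth_manifold B" and F: "smooth_manifold F"
begin

lemma chart_inv_prod:
  assumes "c \<in> atlas B" "d \<in> atlas F" "x \<in> chart_image c" "y \<in> chart_image d"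
  shows "chart_inv (prod_chart c d) (x, y) = (chart_inv c x, chart_inv d y)"
proof -
  have "inj_on (map_prod (snd c) (snd d)) (fst c \<times> fst d)"
    by (intro map_prod_inj_on chart_inv_chart(6)[OF B assms(1)] chart_inv_chart(6)[OF F assms(2)])
  then show ?thesis
    unfolding chart_inv_def[of "prod_chart c d"] fst_conv snd_conv
    by (rule inv_into_f_eq)
      (use chart_inv_chart(2,3)[OF B assms(1,3)] chart_inv_chart(2,3)[OF F assms(2,4)] in auto)
qed

lemma open_prod_chart:
  "c \<in> atlas B \<Longrightarrow> d \<in> atlas F \<Longrightarrow> open (chart_image c \<times> chart_image d)"
  by (intro open_Times chart_inv_chart(4)[OF B] chart_inv_chart(4)[OF F])

lemma smooth_fun_fst:
  assumes "smooth_fun B u" shows "smooth_fun (prod_manifold B F) (u \<circ> fst)"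
proof -
  have "smooth_on (u \<circ> fst \<circ> chart_inv (prod_chart c d)) (chart_image c \<times> chart_image d)"
    if "c \<in> atlas B" "d \<in> atlas F" for c d
    by (rule smooth_on_cong[OF open_prod_chart[OF that]
          smooth_on_linear_compose[OF open_prod_chart[OF that] smooth_funD[OF assms that(1)], of fst]])
      (auto simp: chart_inv_prod that bounded_linear.linear[OF bounded_linear_fst])
  then show ?thesis
    unfolding smooth_fun_def ball_atlas_prod chart_image_prod by blast
qed

lemma smooth_fun_snd:
  assumes "smooth_fun F u" shows "smooth_fun (prod_manifold B F) (u \<circ> snd)"
proof -
  have "smooth_on (u \<circ> snd \<circ> chart_inv (prod_chart c d)) (chart_image c \<times> chart_image d)"
    if "c \<in> atlas B" "d \<in> atlas F" for c d
    by (rule smooth_on_cong[OF open_prod_chart[OF that]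
          smooth_on_linear_compose[OF open_prod_chart[OF that] smooth_funD[OF assms that(2)], of snd]])
      (auto simp: chart_inv_prod that bounded_linear.linear[OF bounded_linear_snd])
  then show ?thesis
    unfolding smooth_fun_def ball_atlas_prod chart_image_prod by blast
qed

text \<open>The pushforward tests on \<open>u o fst\<close> or \<open>u o snd\<close>. Smoothness of
  these on the product ensures that \<open>coord_vec\<close> returns a derivative there and not its
  default value.\<close>

lemma pushforward_coord_vec:
  assumes c: "c \<in> atlas B" and d: "d \<in> atlas F" and z: "z \<in> chart_image c \<times> chart_image d"
  shows "pushforward B fst (coord_vec (prod_manifold B F) (prod_chart c d) z v) = coord_vec B c (fst z) (fst v)"
    and "pushforward F snd (coord_vec (prod_manifold B F) (prod_chart c d) z v) = coord_vec F d (snd z) (snd v)"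
proof -
  have 1: "pderiv_along v (u \<circ> fst \<circ> chart_inv (prod_chart c d)) z = pderiv_along (fst v) (u \<circ> chart_inv c) (fst z)"
    if u: "smooth_fun B u" for u
  proof -
    have "pderiv_along v (u \<circ> fst \<circ> chart_inv (prod_chart c d)) z = pderiv_along v (\<lambda>z. (u \<circ> chart_inv c) (fst z)) z"
      by (rule pderiv_along_cong[OF open_prod_chart[OF c d] z]) (auto simp: chart_inv_prod c d)
    also have "\<dots> = pderiv_along (fst v) (u \<circ> chart_inv c) (fst z)"
      using z by (intro pderiv_along_fst(2) smooth_onD[OF smooth_funD[OF u c]]) auto
    finally show ?thesis .
  qed
  show "pushforward B fst (coord_vec (prod_manifold B F) (prod_chart c d) z v) = coord_vec B c (fst z) (fst v)"
    using 1 smooth_fun_fst by (auto simp: pushforward_def coord_vec_def pderiv_along_def)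
  have 2: "pderiv_along v (u \<circ> snd \<circ> chart_inv (prod_chart c d)) z = pderiv_along (snd v) (u \<circ> chart_inv d) (snd z)"
    if u: "smooth_fun F u" for u
  proof -
    have "pderiv_along v (u \<circ> snd \<circ> chart_inv (prod_chart c d)) z = pderiv_along v (\<lambda>z. (u \<circ> chart_inv d) (snd z)) z"
      by (rule pderiv_along_cong[OF open_prod_chart[OF c d] z]) (auto simp: chart_inv_prod c d)
    also have "\<dots> = pderiv_along (snd v) (u \<circ> chart_inv d) (snd z)"
      using z by (intro pderiv_along_snd(2) smooth_onD[OF smooth_funD[OF u d]]) auto
    finally show ?thesis .
  qed
  show "pushforward F snd (coord_vec (prod_manifold B F) (prod_chart c d) z v) = coord_vec F d (snd z) (snd v)"
    using 2 smooth_fun_snd by (auto simp: pushforward_def coord_vec_def pderiv_along_def)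
qed

lemma components_warped_metric:
  assumes "c \<in> atlas B" "d \<in> atlas F" "z \<in> chart_image c \<times> chart_image d"
  shows "components (prod_manifold B F) (warped_metric B gB f F gF) (prod_chart c d) z
    = warped_form (components B gB c) (f \<circ> chart_inv c) (components F gF d) z"
proof (intro ext)
  fix v w
  obtain x y where z: "z = (x, y)" by (cases z)
  have "chart_inv (prod_chart c d) z = (chart_inv c x, chart_inv d y)"
    using chart_inv_prod[OF assms(1,2)] assms(3) z by simp
  then show "components (prod_manifold B F) (warped_metric B gB f F gF) (prod_chart c d) z v w
    = warped_form (components B gB c) (f \<circ> chart_inv c) (components F gF d) z v w"
    unfolding components_def warped_metric_def warped_form_def pushforward_coord_vec[OF assms]
    by (simp add: z pushforward_coord_vec[OF assms, unfolded z])
qed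

end

lemma warped_coordinates_components:
  assumes gB: "pseudo_Riemannian B gB" and gF: "pseudo_Riemannian F gF"
    and f: "smooth_fun B f" "\<forall>x\<in>points B. f x > 0"
    and c: "c \<in> atlas B" and d: "d \<in> atlas F"
  shows "warped_coordinates (components B gB c) (chart_image c) (components F gF d) (chart_image d)
    (f \<circ> chart_inv c)"
proof -
  have B: "smooth_manifold B" using gB by (simp add: pseudo_Riemannian_def)
  interpret A: coordinate_metric "components B gB c" "chart_image c"
    by (rule coordinate_metric_components[OF gB c])
  interpret C: coordinate_metric "components F gF d" "chart_image d"
    by (rule coordinate_metric_components[OF gF d])
  show ?thesis
  proof
    show "smooth_on (f \<circ> chart_inv c) (chart_image c)" by (rule smooth_funD[OF f(1) c])
    show "0 < (f \<circ> chart_inv c) x" if "x \<in> chart_image c" for x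
      using f(2) chart_inv_chart(3,5)[OF B c] that by auto
  qed
qed

section \<open>Yamabe solitons on warped products\<close>

text \<open>The splitting of \<open>h\<close> is given on points of the product, and the block form
  of the metric on the chart domain. Both are exchanged inside the scalar curvature and the Hessian
  by locality.\<close>

lemma Yamabe_equation_warped:
  assumes gB: "pseudo_Riemannian B gB" and gF: "pseudo_Riemannian F gF"
    and f: "smooth_fun B f" "\<forall>x\<in>points B. f x > 0"
    and h: "\<forall>x\<in>points B. \<forall>y\<in>points F. h (x, y) = h1 x + h2 y"
    and Y: "Yamabe_equation (prod_manifold B F) (warped_metric B gB f F gF) (\<lambda>_. \<rho>) h"
    and c: "c \<in> atlas B" and d: "d \<in> atlas F" and x: "x \<in> chart_image c" and y: "y \<in> chart_image d"
  defines "G \<equiv> warped_form (components B gB c) (f \<circ> chart_inv c) (components F gF d)"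
  shows "(scalar_curvature G (x, y) - \<rho>) * G (x, y) v w
    = hessian G (\<lambda>z. (h1 \<circ> chart_inv c) (fst z) + (h2 \<circ> chart_inv d) (snd z)) (x, y) v w"
proof -
  have B: "smooth_manifold B" and F: "smooth_manifold F"
    using gB gF by (simp_all add: pseudo_Riemannian_def)
  let ?C = "components (prod_manifold B F) (warped_metric B gB f F gF) (prod_chart c d)"
  have xy: "(x, y) \<in> chart_image c \<times> chart_image d" using x y by simp
  have G: "?C z = G z" if "z \<in> chart_image c \<times> chart_image d" for z
    unfolding G_def by (rule components_warped_metric[OF B F c d that])
  have hh: "(h \<circ> chart_inv (prod_chart c d)) z = (h1 \<circ> chart_inv c) (fst z) + (h2 \<circ> chart_inv d) (snd z)"
    if "z \<in> chart_image c \<times> chart_image d" for z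
  proof -
    obtain a b where z: "z = (a, b)" by (cases z)
    have "chart_inv c a \<in> points B" "chart_inv d b \<in> points F"
      using that z chart_inv_chart(3,5)[OF B c] chart_inv_chart(3,5)[OF F d] by auto
    then show ?thesis using that z h by (simp add: chart_inv_prod[OF B F c d])
  qed
  have "(scalar_curvature ?C (x, y) - \<rho>) * ?C (x, y) v w
    = hessian ?C (h \<circ> chart_inv (prod_chart c d)) (x, y) v w"
    using Y c d xy unfolding Yamabe_equation_def ball_atlas_prod chart_image_prod by blast
  moreover have "scalar_curvature ?C (x, y) = scalar_curvature G (x, y)"
    by (rule scalar_curvature_cong[OF open_prod_chart[OF B F c d] xy G])
  moreover have "hessian ?C (h \<circ> chart_inv (prod_chart c d)) (x, y) v w
    = hessian G (\<lambda>z. (h1 \<circ> chart_inv c) (fst z) + (h2 \<circ> chart_inv d) (snd z)) (x, y) v w"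
    by (rule hessian_cong[OF open_prod_chart[OF B F c d] xy G hh])
  ultimately show ?thesis by (simp only: G[OF xy])
qed

text \<open>For dividing a tensor equation by the metric. Two vectors are taken because a given
  nonzero vector may be null.\<close>

lemma form_nonzero:
  assumes "nondegenerate_form (b :: 'e::euclidean_space \<Rightarrow> _)"
  obtains v w where "b v w \<noteq> 0"
proof -
  obtain i :: 'e where "i \<in> Basis" using nonempty_Basis by blast
  then have "i \<noteq> 0" by (rule nonzero_Basis)
  then show thesis using that assms unfolding nondegenerate_form_def by blast
qed

lemma hessian_of_constant:
  assumes "coordinate_metric G U" "x \<in> U" "\<And>y. y \<in> U \<Longrightarrow> u y = a"
  shows "hessian G u x v w = 0"
proof -
  have "hessian G u x v w = hessian G (\<lambda>_. a) x v w"
    using assms by (intro hessian_cong[of U] coordinate_metric.open_U) auto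
  then show ?thesis by (simp add: hessian_def pderiv_along_def[abs_def])
qed

text \<open>The alternatives are separated by the differential of \<open>f\<close>. If it vanishes
  everywhere, connectedness of the base makes \<open>f\<close> constant and the second alternative
  results, of which the first is a special case. Otherwise connectedness of the fiber makes
  \<open>h2\<close> constant and the third results.\<close>

theorem theorem1p4:
  fixes B :: "('p, 'e::euclidean_space) manifold" and gB :: "'p form2"
    and F :: "('q, 'f::euclidean_space) manifold" and gF :: "'q form2"
    and f h1 :: "'p \<Rightarrow> real" and h2 :: "'q \<Rightarrow> real" and h :: "'p \<times> 'q \<Rightarrow> real"
  assumes "pseudo_Riemannian B gB" and "connected_space (top_of B)"
    and "pseudo_Riemannian F gF" and "connected_space (top_of F)"
    and "DIM('f) > 1"
    and "smooth_fun B f" and "\<forall>x\<in>points B. f x > 0"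
    and "smooth_fun B h1" and "smooth_fun F h2"
    and "\<forall>x\<in>points B. \<forall>y\<in>points F. h (x, y) = h1 x + h2 y"
    and "gradient_Yamabe_soliton (prod_manifold B F) (warped_metric B gB f F gF) h"
  shows
    "(constant_fun B f \<and>
        (trivial_gradient_Yamabe_soliton B gB h1 \<and> gradient_Yamabe_soliton F gF h2 \<or>
         gradient_Yamabe_soliton B gB h1 \<and> trivial_gradient_Yamabe_soliton F gF h2)) \<or>
     (constant_fun B f \<and> gradient_Yamabe_soliton B gB h1 \<and> gradient_Yamabe_soliton F gF h2) \<or>
     (almost_gradient_Yamabe_soliton B gB h1 \<and> trivial_gradient_Yamabe_soliton F gF h2)"
proof -
  note gB = assms(1) and gF = assms(3) and f = assms(6,7) and h1 = assms(8) and h2 = assms(9)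
  have B: "smooth_manifold B" and F: "smooth_manifold F"
    using gB gF by (simp_all add: pseudo_Riemannian_def)
  obtain \<rho> where Y: "Yamabe_equation (prod_manifold B F) (warped_metric B gB f F gF) (\<lambda>_. \<rho>) h"
    using assms(11) unfolding gradient_Yamabe_soliton_def by blast
  define A where "A c = components B gB c" for c :: "('p, 'e) chart"
  define C where "C d = components F gF d" for d :: "('q, 'f) chart"
  define \<phi> where "\<phi> c = f \<circ> chart_inv c" for c :: "('p, 'e) chart"
  define H1 where "H1 c = h1 \<circ> chart_inv c" for c :: "('p, 'e) chart"
  define H2 where "H2 d = h2 \<circ> chart_inv d" for d :: "('q, 'f) chart"
  have A: "coordinate_metric (A c) (chart_image c)" if "c \<in> atlas B" for c
    unfolding A_def by (rule coordinate_metric_components[OF gB that])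
  have C: "coordinate_metric (C d) (chart_image d)" if "d \<in> atlas F" for d
    unfolding C_def by (rule coordinate_metric_components[OF gF that])
  have W: "warped_coordinates (A c) (chart_image c) (C d) (chart_image d) (\<phi> c)"
    if "c \<in> atlas B" "d \<in> atlas F" for c d
    unfolding A_def C_def \<phi>_def by (rule warped_coordinates_components[OF gB gF f that])
  have s\<phi>: "smooth_on (\<phi> c) (chart_image c)" and sH1: "smooth_on (H1 c) (chart_image c)" if "c \<in> atlas B" for c
    using smooth_funD[OF f(1) that] smooth_funD[OF h1 that] by (simp_all add: \<phi>_def H1_def)
  have sH2: "smooth_on (H2 d) (chart_image d)" if "d \<in> atlas F" for d
    using smooth_funD[OF h2 that] by (simp add: H2_def)
  have pos: "\<phi> c x > 0" if "c \<in> atlas B" "x \<in> chart_image c" for c x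
    using f(2) chart_inv_chart(3,5)[OF B that(1)] that(2) by (auto simp: \<phi>_def)
  let ?n = "real DIM('f)"
  \<comment> \<open>The part of the scalar curvature caused by the warping. It depends on the base
    point alone and vanishes for constant \<phi>.\<close>
  define K where "K c x = 2 * ?n * laplacian (A c) (\<phi> c) x / \<phi> c x
    + ?n * (?n - 1) * pderiv_along (gradient (A c) (\<phi> c) x) (\<phi> c) x / (\<phi> c x)\<^sup>2" for c x
  define S where "S c d x y = scalar_curvature (A c) x + scalar_curvature (C d) y / (\<phi> c x)\<^sup>2 - K c x" for c d x y
  have S: "scalar_curvature (warped_form (A c) (\<phi> c) (C d)) (x, y) = S c d x y"
    if "c \<in> atlas B" "d \<in> atlas F" "x \<in> chart_image c" "y \<in> chart_image d" for c d x y
    using warped_coordinates.scalar_curvature_warped[OF W[OF that(1,2)] that(3,4)]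
    by (simp add: S_def K_def)
  have E: "(S c d x y - \<rho>) * warped_form (A c) (\<phi> c) (C d) (x, y) v w
    = hessian (A c) (H1 c) x (fst v) (fst w) + hessian (C d) (H2 d) y (snd v) (snd w)
      + C d y (snd v) (snd w) * \<phi> c x * pderiv_along (gradient (A c) (\<phi> c) x) (H1 c) x
      - pderiv_along (fst v) (\<phi> c) x / \<phi> c x * pderiv_along (snd w) (H2 d) y
      - pderiv_along (fst w) (\<phi> c) x / \<phi> c x * pderiv_along (snd v) (H2 d) y"
    if "c \<in> atlas B" "d \<in> atlas F" "x \<in> chart_image c" "y \<in> chart_image d" for c d x y v w
    using Yamabe_equation_warped[OF gB gF f assms(10) Y that, of v w]
      warped_coordinates.hessian_warped[OF W[OF that(1,2)] that(3,4) sH1[OF that(1)] sH2[OF that(2)], of v w]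
      S[OF that]
    by (simp add: A_def C_def \<phi>_def H1_def H2_def)
  have zeros: "A c x v 0 = 0" "A c x 0 v = 0" "C d y w 0 = 0" "C d y 0 w = 0"
    "pderiv_along 0 (\<phi> c) x = 0" "pderiv_along 0 (H1 c) x = 0" "pderiv_along 0 (H2 d) y = 0"
    "hessian (A c) (H1 c) x v 0 = 0" "hessian (A c) (H1 c) x 0 v = 0"
    "hessian (C d) (H2 d) y w 0 = 0" "hessian (C d) (H2 d) y 0 w = 0"
    if "c \<in> atlas B" "d \<in> atlas F" "x \<in> chart_image c" "y \<in> chart_image d" for c d x y v w
  proof -
    note a = coordinate_metric.bilinear[OF A[OF that(1)] that(3)]
      and c = coordinate_metric.bilinear[OF C[OF that(2)] that(4)]
    show "A c x v 0 = 0" "A c x 0 v = 0" "C d y w 0 = 0" "C d y 0 w = 0" for v w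
      by (simp_all add: bilinear_lzero[OF a] bilinear_rzero[OF a] bilinear_lzero[OF c] bilinear_rzero[OF c])
    \<comment> \<open>The definition of the Hessian is not visibly bilinear; its expression through
      the derivative of the gradient is.\<close>
    then show "hessian (A c) (H1 c) x v 0 = 0" "hessian (A c) (H1 c) x 0 v = 0"
      "hessian (C d) (H2 d) y w 0 = 0" "hessian (C d) (H2 d) y 0 w = 0" for v w
      by (simp_all add: coordinate_metric.hessian_eq_gradient[OF A[OF that(1)] that(3) sH1[OF that(1)]]
          coordinate_metric.hessian_eq_gradient[OF C[OF that(2)] that(4) sH2[OF that(2)]]
          linear_0[OF linear_pderiv_along]
          smooth_onD[OF coordinate_metric.smooth_gradient[OF A[OF that(1)] sH1[OF that(1)]] that(3)]
          smooth_onD[OF coordinate_metric.smooth_gradient[OF C[OF that(2)] sH2[OF that(2)]] that(4)]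
          coordinate_metric.christoffel_commute[OF A[OF that(1)] that(3), of 0]
          coordinate_metric.christoffel_commute[OF C[OF that(2)] that(4), of 0]
          linear_0[OF coordinate_metric.linear_christoffel[OF A[OF that(1)] that(3)]]
          linear_0[OF coordinate_metric.linear_christoffel[OF C[OF that(2)] that(4)]])
    show "pderiv_along 0 (\<phi> c) x = 0" "pderiv_along 0 (H1 c) x = 0" "pderiv_along 0 (H2 d) y = 0"
      by (intro pderiv_along_zero smooth_onD[OF s\<phi>] smooth_onD[OF sH1] smooth_onD[OF sH2] that)+
  qed
  have base: "(S c d x y - \<rho>) * A c x v w = hessian (A c) (H1 c) x v w"
    if "c \<in> atlas B" "d \<in> atlas F" "x \<in> chart_image c" "y \<in> chart_image d" for c d x y v w
    using E[OF that, of "(v, 0)" "(w, 0)"] by (simp add: warped_form_def zeros[OF that])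
  have mixed: "pderiv_along v (\<phi> c) x * pderiv_along w (H2 d) y = 0"
    if "c \<in> atlas B" "d \<in> atlas F" "x \<in> chart_image c" "y \<in> chart_image d" for c d x y v w
    using E[OF that, of "(v, 0)" "(0, w)"] pos[OF that(1,3)]
    by (simp add: warped_form_def zeros[OF that])
  have fiber: "(S c d x y - \<rho>) * (\<phi> c x)\<^sup>2 * C d y v w = hessian (C d) (H2 d) y v w
      + C d y v w * \<phi> c x * pderiv_along (gradient (A c) (\<phi> c) x) (H1 c) x"
    if "c \<in> atlas B" "d \<in> atlas F" "x \<in> chart_image c" "y \<in> chart_image d" for c d x y v w
    using E[OF that, of "(0, v)" "(0, w)"] by (simp add: warped_form_def zeros[OF that])
  \<comment> \<open>The right-hand side of \<open>base\<close> does not contain the fiber point, so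
    division by a nonzero value of \<open>A c x\<close> gives the claim.\<close>
  have S_fiber: "S c d x y = S c d' x y'"
    if t: "c \<in> atlas B" "d \<in> atlas F" "d' \<in> atlas F" "x \<in> chart_image c" "y \<in> chart_image d" "y' \<in> chart_image d'"
    for c d d' x y y'
  proof -
    obtain v w where "A c x v w \<noteq> 0"
      using form_nonzero[OF coordinate_metric.nondegenerate[OF A[OF t(1)] t(4)]] by blast
    then show ?thesis
      using base[OF t(1,2,4,5), of v w] base[OF t(1,3,4,6), of v w] by (metis mult_cancel_right diff_add_cancel)
  qed
  \<comment> \<open>Reference points in both factors; fixing one of them turns an equation on the
    product into one on the other factor.\<close>
  obtain p0 where "p0 \<in> points B" using B unfolding smooth_manifold_def by blast
  then obtain c0 x0 where c0: "c0 \<in> atlas B" "x0 \<in> chart_image c0"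
    using obtain_chart[OF B] by metis
  obtain q0 where "q0 \<in> points F" using F unfolding smooth_manifold_def by blast
  then obtain d0 y0 where d0: "d0 \<in> atlas F" "y0 \<in> chart_image d0"
    using obtain_chart[OF F] by metis
  define s where "s = scalar_curvature (C d0) y0"
  \<comment> \<open>Over the fixed base point \<open>x0\<close> all summands of \<open>S\<close>
    except the one with the fiber curvature are the same, and its factor \<open>1 / \<phi>^2\<close>
    is nonzero.\<close>
  have s: "scalar_curvature (C d) y = s" if "d \<in> atlas F" "y \<in> chart_image d" for d y
    using S_fiber[OF c0(1) that(1) d0(1) c0(2) that(2) d0(2)] pos[OF c0] by (simp add: S_def s_def)
  show ?thesis
  proof (cases "\<forall>c\<in>atlas B. \<forall>x\<in>chart_image c. \<forall>v. pderiv_along v (\<phi> c) x = 0")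
    case True
    then have "constant_fun B f"
      by (intro constant_fun_of_pderiv_along[OF B assms(2) f(1)]) (simp add: \<phi>_def)
    then obtain a where a: "\<And>p. p \<in> points B \<Longrightarrow> f p = a" by (auto simp: constant_fun_def)
    have \<phi>: "\<phi> c x = a" if "c \<in> atlas B" "x \<in> chart_image c" for c x
      using a chart_inv_chart(3,5)[OF B that(1)] that(2) by (auto simp: \<phi>_def)
    have a0: "a \<noteq> 0" using pos[OF c0] \<phi>[OF c0] by simp
    have grad: "gradient (A c) (\<phi> c) x = 0" if "c \<in> atlas B" "x \<in> chart_image c" for c x
      unfolding gradient_def
      by (rule sharp_eqI[OF coordinate_metric.nondegenerate[OF A[OF that(1)] that(2)]])
        (use True that zeros[OF that(1) d0(1) that(2) d0(2)] in simp)
    have lap: "laplacian (A c) (\<phi> c) x = 0" if "c \<in> atlas B" "x \<in> chart_image c" for c x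
      unfolding laplacian_def
      using metric_trace_eq[OF coordinate_metric.nondegenerate[OF A[OF that(1)] that(2)], of "hessian (A c) (\<phi> c) x" "\<lambda>_. 0"]
        hessian_of_constant[OF A[OF that(1)] that(2) \<phi>] that(1) zeros[OF that(1) d0(1) that(2) d0(2)]
      by simp
    have S': "S c d x y = scalar_curvature (A c) x + s / a\<^sup>2"
      if "c \<in> atlas B" "d \<in> atlas F" "x \<in> chart_image c" "y \<in> chart_image d" for c d x y
      using that by (simp add: S_def K_def \<phi> grad lap s zeros[OF that])
    \<comment> \<open>The scalar curvature of the product exceeds that of the base by the constant
      \<open>s / a^2\<close>, which is moved into the soliton constant.\<close>
    have "Yamabe_equation B gB (\<lambda>_. \<rho> - s / a\<^sup>2) h1"
      unfolding Yamabe_equation_def A_def[symmetric] H1_def[symmetric]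
      using base[OF _ d0(1) _ d0(2)] S'[OF _ d0(1) _ d0(2)] by (simp add: algebra_simps)
    then have "gradient_Yamabe_soliton B gB h1"
      unfolding gradient_Yamabe_soliton_def using gB h1 by blast
    \<comment> \<open>The fiber equation over \<open>x0\<close> has the coefficient
      \<open>(S - \<rho>) a^2\<close> in front of \<open>C\<close>. The soliton constant is the
      number that must be subtracted from \<open>s\<close> to obtain it.\<close>
    moreover have "Yamabe_equation F gF (\<lambda>_. s - (scalar_curvature (A c0) x0 + s / a\<^sup>2 - \<rho>) * a\<^sup>2) h2"
      unfolding Yamabe_equation_def C_def[symmetric] H2_def[symmetric]
      using fiber[OF c0(1) _ c0(2)] S'[OF c0(1) _ c0(2)]
      by (simp add: s grad[OF c0] \<phi>[OF c0] zeros[OF c0(1) d0(1) c0(2) d0(2)])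
    then have "gradient_Yamabe_soliton F gF h2"
      unfolding gradient_Yamabe_soliton_def using gF h2 by blast
    ultimately show ?thesis using \<open>constant_fun B f\<close> by blast
  next
    case False
    then obtain c1 x1 v1 where c1: "c1 \<in> atlas B" "x1 \<in> chart_image c1" "pderiv_along v1 (\<phi> c1) x1 \<noteq> 0"
      by blast
    \<comment> \<open>In \<open>mixed\<close> the base point and the fiber point vary independently,
      so one point with nonzero differential of \<phi> forces the differential of \<open>h2\<close>
      to vanish on the whole fiber.\<close>
    then have "pderiv_along w (H2 d) y = 0" if "d \<in> atlas F" "y \<in> chart_image d" for d y w
      using mixed[OF c1(1) that(1) c1(2) that(2), of v1 w] by simp
    then have const: "constant_fun F h2"
      by (intro constant_fun_of_pderiv_along[OF F assms(4) h2]) (simp add: H2_def)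
    then obtain a where a: "\<And>q. q \<in> points F \<Longrightarrow> h2 q = a" by (auto simp: constant_fun_def)
    have H2: "H2 d y = a" if "d \<in> atlas F" "y \<in> chart_image d" for d y
      using a chart_inv_chart(3,5)[OF F that(1)] that(2) by (auto simp: H2_def)
    \<comment> \<open>Both sides are 0: the soliton constant is the scalar curvature itself, and
      \<open>h2\<close> is constant.\<close>
    have "Yamabe_equation F gF (\<lambda>_. s) h2"
      unfolding Yamabe_equation_def C_def[symmetric] H2_def[symmetric]
      using s hessian_of_constant[OF C _ H2] by simp
    then have triv: "trivial_gradient_Yamabe_soliton F gF h2"
      unfolding trivial_gradient_Yamabe_soliton_def gradient_Yamabe_soliton_def using gF h2 const by blast
    \<comment> \<open>Chosen so that the scalar curvature of the base minus \<open>\<rho>B\<close>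
      equals \<open>S - \<rho>\<close>. Quotients are written as products with inverses, to match
      the closure rules for smooth functions.\<close>
    define \<rho>B where "\<rho>B p = \<rho> - (s * (inverse (f p) * inverse (f p))
      - (2 * ?n * (manifold_laplacian B gB f p * inverse (f p))
        + ?n * (?n - 1) * (gradient_square B gB f p * (inverse (f p) * inverse (f p)))))" for p
    have \<rho>B: "(\<rho>B \<circ> chart_inv c) x = \<rho> - (s * (inverse (\<phi> c x) * inverse (\<phi> c x))
      - (2 * ?n * (laplacian (A c) (\<phi> c) x * inverse (\<phi> c x))
        + ?n * (?n - 1) * (pderiv_along (gradient (A c) (\<phi> c) x) (\<phi> c) x * (inverse (\<phi> c x) * inverse (\<phi> c x)))))"
      if "c \<in> atlas B" "x \<in> chart_image c" for c x
      using manifold_laplacian_chart[OF gB f(1) that] gradient_square_chart[OF gB f(1) that]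
      by (simp add: \<rho>B_def A_def \<phi>_def)
    have "smooth_on (\<rho>B \<circ> chart_inv c) (chart_image c)" if c: "c \<in> atlas B" for c
    proof -
      note o = chart_inv_chart(4)[OF B c]
      have inv: "smooth_on (\<lambda>x. inverse (\<phi> c x)) (chart_image c)"
        by (rule smooth_on_inverse[OF o s\<phi>[OF c]]) (use pos[OF c] in force)
      have "smooth_on (\<lambda>x. \<rho> - (s * (inverse (\<phi> c x) * inverse (\<phi> c x))
      - (2 * ?n * (laplacian (A c) (\<phi> c) x * inverse (\<phi> c x))
        + ?n * (?n - 1) * (pderiv_along (gradient (A c) (\<phi> c) x) (\<phi> c) x * (inverse (\<phi> c x) * inverse (\<phi> c x))))))
        (chart_image c)"
        by (intro smooth_on_diff smooth_on_add smooth_on_mult smooth_on_const o inv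
            coordinate_metric.smooth_laplacian[OF A[OF c] s\<phi>[OF c]]
            coordinate_metric.smooth_pderiv_along_variable[OF A[OF c] s\<phi>[OF c]]
            coordinate_metric.smooth_gradient[OF A[OF c] s\<phi>[OF c]])
      then show ?thesis
        by (rule smooth_on_cong[OF o]) (rule \<rho>B[OF c, symmetric])
    qed
    then have "smooth_fun B \<rho>B" by (simp add: smooth_fun_def)
    moreover have "Yamabe_equation B gB \<rho>B h1"
      unfolding Yamabe_equation_def A_def[symmetric] H1_def[symmetric]
    proof (intro ballI allI)
      fix c x v w assume cx: "c \<in> atlas B" "x \<in> chart_image c"
      have "scalar_curvature (A c) x - \<rho>B (chart_inv c x) = S c d0 x y0 - \<rho>"
        using \<rho>B[OF cx] by (simp add: S_def K_def s[OF d0] divide_inverse power2_eq_square algebra_simps)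
      then show "(scalar_curvature (A c) x - \<rho>B (chart_inv c x)) * A c x v w = hessian (A c) (H1 c) x v w"
        using base[OF cx(1) d0(1) cx(2) d0(2)] by simp
    qed
    ultimately show ?thesis
      using triv gB h1 unfolding almost_gradient_Yamabe_soliton_def by blast
  qed
qed

end
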